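(* Let $\mathbf{M}=(M,d)$ be a nonempty ultrametric space. The following properties are equivalent: (i) $\mathbf{M}$ is separable, Cauchy complete and homogeneous; (ii) $\mathbf{M}$ is isometric to the Cauchy completion of a space of the form $\mathbf{M}_{\mathbf{s}}(\mathrm{Fin}(V))$, where $V$ is a countable subset of $\mathbb{R}^+$ containing $0$ and $\mathbf{s}$ is a map from $V_*=V\setminus\{0\}$ into $(\omega+1)\setminus 2=\{2,3,\dots\}\cup\{\omega\}$.
   Context: $\mathbb{R}^+$ is the set of non-negative reals. A metric space $(M,d)$ is ultrametric if $d(x,z)\le\max\{d(x,y),d(y,z)\}$ for all $x,y,z$. It is homogeneous if every isometry between finite subsets extends to a surjective isometry of the whole space onto itself. Countable means finite or countably infinite. Each value $\mathbf{s}(r)$ is viewed as an ordinal. For $f\in\prod_{r\in V_*}\mathbf{s}(r)$ the support is $\mathrm{supp}(f)=\{r\in V_*:f(r)\ne0\}$. $\mathrm{Fin}(V)$ is the collection of finite subsets of $V_*$, and $\mathbf{M}_{\mathbf{s}}(\mathrm{Fin}(V))$ is the set of $f\in\prod_{r\in V_*}\mathbf{s}(r)$ with finite support, with the distance $d(f,f)=0$ and $d(f,g)=\max\{r\in V_*:f(r)\ne g(r)\}$ for $f\ne g$. *)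

theory Defs
  imports "HOL-Analysis.Analysis"
begin

section \<open>Isometries, ultrametric and homogeneous spaces\<close>

definition ultrametric :: "'a metric \<Rightarrow> bool" where
  "ultrametric X \<longleftrightarrow>
    (\<forall>x\<in>mspace X. \<forall>y\<in>mspace X. \<forall>z\<in>mspace X.
      mdist X x z \<le> max (mdist X x y) (mdist X y z))"

definition isometry_onto :: "'a metric \<Rightarrow> 'b metric \<Rightarrow> ('a \<Rightarrow> 'b) \<Rightarrow> bool" where
  "isometry_onto X Y f \<longleftrightarrow>
    f ` mspace X = mspace Y \<and>
    (\<forall>x\<in>mspace X. \<forall>y\<in>mspace X. mdist Y (f x) (f y) = mdist X x y)"

definition isometric :: "'a metric \<Rightarrow> 'b metric \<Rightarrow> bool" where
  "isometric X Y \<longleftrightarrow> (\<exists>f. isometry_onto X Y f)"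

definition homogeneous :: "'a metric \<Rightarrow> bool" where
  "homogeneous X \<longleftrightarrow>
    (\<forall>A B f. finite A \<and> A \<subseteq> mspace X \<and> finite B \<and> B \<subseteq> mspace X \<and>
        isometry_onto (submetric X A) (submetric X B) f \<longrightarrow>
      (\<exists>g. isometry_onto X X g \<and> (\<forall>x\<in>A. g x = f x)))"

section \<open>Cauchy completion\<close>

definition Cauchy_seqs :: "'a metric \<Rightarrow> (nat \<Rightarrow> 'a) set" where
  "Cauchy_seqs X = {x. Metric_space.MCauchy (mspace X) (mdist X) x}"

definition Cauchy_equiv :: "'a metric \<Rightarrow> ((nat \<Rightarrow> 'a) \<times> (nat \<Rightarrow> 'a)) set" where
  "Cauchy_equiv X = {(x, y). x \<in> Cauchy_seqs X \<and> y \<in> Cauchy_seqs X \<and>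
      (\<lambda>n. mdist X (x n) (y n)) \<longlonglongrightarrow> 0}"

definition completion_space :: "'a metric \<Rightarrow> (nat \<Rightarrow> 'a) set set" where
  "completion_space X = Cauchy_seqs X // Cauchy_equiv X"

text \<open>
  A metric in the sense of \<^locale>\<open>Metric_space\<close> has to be non-negative and symmetric also outside
  its carrier; hence the value 0 there. On the carrier the limit exists and does not depend
  on the representatives, see \<open>completion_dist_eq\<close> below.
\<close>
definition completion_dist :: "'a metric \<Rightarrow> (nat \<Rightarrow> 'a) set \<Rightarrow> (nat \<Rightarrow> 'a) set \<Rightarrow> real" where
  "completion_dist X A B =
    (if A \<in> completion_space X \<and> B \<in> completion_space X
     then THE l. \<forall>x\<in>A. \<forall>y\<in>B. (\<lambda>n. mdist X (x n) (y n)) \<longlonglongrightarrow> l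
     else 0)"

definition Cauchy_completion :: "'a metric \<Rightarrow> (nat \<Rightarrow> 'a) set metric" where
  "Cauchy_completion X = metric (completion_space X, completion_dist X)"

lemma Cauchy_seqs_mspace: "x \<in> Cauchy_seqs X \<Longrightarrow> x n \<in> mspace X"
  unfolding Cauchy_seqs_def
  by (auto simp: Metric_space.MCauchy_def)

lemma Cauchy_seqs_bound:
  assumes "x \<in> Cauchy_seqs X" "e > 0"
  shows "\<exists>N. \<forall>n\<ge>N. \<forall>m\<ge>N. mdist X (x n) (x m) < e"
  using assms unfolding Cauchy_seqs_def by (auto simp: Metric_space.MCauchy_def)

lemma mdist_quadrilateral:
  assumes "a \<in> mspace X" "b \<in> mspace X" "a' \<in> mspace X" "b' \<in> mspace X"
  shows "\<bar>mdist X a b - mdist X a' b'\<bar> \<le> mdist X a a' + mdist X b b'"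
  using mdist_triangle[of a X a' b] mdist_triangle[of a' X b' b] mdist_triangle[of a' X a b']
    mdist_triangle[of a X b b'] assms mdist_commute[of X a a'] mdist_commute[of X b b'] by linarith

lemma Cauchy_seqs_dist_convergent:
  assumes x: "x \<in> Cauchy_seqs X" and y: "y \<in> Cauchy_seqs X"
  shows "\<exists>l. (\<lambda>n. mdist X (x n) (y n)) \<longlonglongrightarrow> l"
proof -
  have "Cauchy (\<lambda>n. mdist X (x n) (y n))"
  proof (rule metric_CauchyI)
    fix e :: real assume "e > 0"
    then have e: "e/2 > 0" by simp
    obtain N where N: "\<forall>n\<ge>N. \<forall>m\<ge>N. mdist X (x n) (x m) < e/2"
      using Cauchy_seqs_bound[OF x e] by blast
    obtain K where K: "\<forall>n\<ge>K. \<forall>m\<ge>K. mdist X (y n) (y m) < e/2"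
      using Cauchy_seqs_bound[OF y e] by blast
    have "dist (mdist X (x m) (y m)) (mdist X (x n) (y n)) < e"
      if "m \<ge> max N K" "n \<ge> max N K" for m n
    proof -
      have "mdist X (x m) (x n) < e/2" "mdist X (y m) (y n) < e/2"
        using N K that by auto
      then show ?thesis
        using mdist_quadrilateral[of "x m" X "y m" "x n" "y n"]
          Cauchy_seqs_mspace[OF x] Cauchy_seqs_mspace[OF y]
        by (simp add: dist_real_def)
    qed
    then show "\<exists>M. \<forall>m\<ge>M. \<forall>n\<ge>M. dist (mdist X (x m) (y m)) (mdist X (x n) (y n)) < e"
      by blast
  qed
  then show ?thesis
    by (meson Cauchy_convergent_iff convergent_def)
qed

lemma equiv_Cauchy_equiv: "equiv (Cauchy_seqs X) (Cauchy_equiv X)"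
proof (rule equivI)
  show "Cauchy_equiv X \<subseteq> Cauchy_seqs X \<times> Cauchy_seqs X"
    by (auto simp: Cauchy_equiv_def)
  show "refl_on (Cauchy_seqs X) (Cauchy_equiv X)"
    by (auto simp: refl_on_def Cauchy_equiv_def Cauchy_seqs_mspace
        Metric_space.mdist_zero[OF Metric_space_mspace_mdist])
  show "sym (Cauchy_equiv X)"
    by (auto simp: sym_def Cauchy_equiv_def mdist_commute)
  show "trans (Cauchy_equiv X)"
  proof (rule transI)
    fix x y z assume "(x, y) \<in> Cauchy_equiv X" "(y, z) \<in> Cauchy_equiv X"
    then have c: "x \<in> Cauchy_seqs X" "y \<in> Cauchy_seqs X" "z \<in> Cauchy_seqs X"
      and l: "(\<lambda>n. mdist X (x n) (y n)) \<longlonglongrightarrow> 0" "(\<lambda>n. mdist X (y n) (z n)) \<longlonglongrightarrow> 0"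
      by (auto simp: Cauchy_equiv_def)
    have s: "(\<lambda>n. mdist X (x n) (y n) + mdist X (y n) (z n)) \<longlonglongrightarrow> 0"
      using tendsto_add[OF l] by simp
    have "(\<lambda>n. mdist X (x n) (z n)) \<longlonglongrightarrow> 0"
      by (rule tendsto_sandwich[OF _ _ tendsto_const s])
        (auto intro!: always_eventually mdist_triangle simp: c Cauchy_seqs_mspace)
    then show "(x, z) \<in> Cauchy_equiv X"
      using c by (simp add: Cauchy_equiv_def)
  qed
qed

lemma completion_space_subset: "A \<in> completion_space X \<Longrightarrow> A \<subseteq> Cauchy_seqs X"
  unfolding completion_space_def
  by (metis Union_quotient Union_upper equiv_Cauchy_equiv)

lemma completion_space_nonempty: "A \<in> completion_space X \<Longrightarrow> \<exists>x. x \<in> A"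
  unfolding completion_space_def
  by (metis all_not_in_conv equiv_Cauchy_equiv in_quotient_imp_non_empty)

lemma completion_dist_eq:
  assumes A: "A \<in> completion_space X" and B: "B \<in> completion_space X"
    and x: "x \<in> A" and y: "y \<in> B"
  shows "(\<lambda>n. mdist X (x n) (y n)) \<longlonglongrightarrow> completion_dist X A B"
proof -
  have cx: "x \<in> Cauchy_seqs X" and cy: "y \<in> Cauchy_seqs X"
    using assms completion_space_subset by blast+
  obtain l where l: "(\<lambda>n. mdist X (x n) (y n)) \<longlonglongrightarrow> l"
    using Cauchy_seqs_dist_convergent[OF cx cy] by blast
  have all: "(\<lambda>n. mdist X (x' n) (y' n)) \<longlonglongrightarrow> l" if "x' \<in> A" "y' \<in> B" for x' y'
  proof -
    have "(x', x) \<in> Cauchy_equiv X" "(y', y) \<in> Cauchy_equiv X"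
      using that A B x y equiv_Cauchy_equiv[of X] unfolding completion_space_def
      by (metis quotient_eq_iff)+
    then have c: "x' \<in> Cauchy_seqs X" "y' \<in> Cauchy_seqs X"
      and z: "(\<lambda>n. mdist X (x' n) (x n)) \<longlonglongrightarrow> 0" "(\<lambda>n. mdist X (y' n) (y n)) \<longlonglongrightarrow> 0"
      by (auto simp: Cauchy_equiv_def)
    have s: "(\<lambda>n. mdist X (x' n) (x n) + mdist X (y' n) (y n)) \<longlonglongrightarrow> 0"
      using tendsto_add[OF z] by simp
    have "(\<lambda>n. mdist X (x' n) (y' n) - mdist X (x n) (y n)) \<longlonglongrightarrow> 0"
      by (rule Lim_null_comparison[OF _ s])
        (auto intro!: always_eventually mdist_quadrilateral
          simp: c cx cy Cauchy_seqs_mspace)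
    from tendsto_add[OF this l] show ?thesis by simp
  qed
  have "(THE l. \<forall>x\<in>A. \<forall>y\<in>B. (\<lambda>n. mdist X (x n) (y n)) \<longlonglongrightarrow> l) = l"
  proof (rule the_equality)
    show "l' = l" if "\<forall>x\<in>A. \<forall>y\<in>B. (\<lambda>n. mdist X (x n) (y n)) \<longlonglongrightarrow> l'" for l'
      using that x y l LIMSEQ_unique by blast
  qed (use all in blast)
  then show ?thesis
    using l A B by (simp add: completion_dist_def)
qed

lemma Metric_space_completion: "Metric_space (completion_space X) (completion_dist X)"
proof
  have nn: "0 \<le> completion_dist X A B" if AB: "A \<in> completion_space X" "B \<in> completion_space X" for A B
  proof -
    obtain x y where "x \<in> A" "y \<in> B" using AB completion_space_nonempty by blast
    from completion_dist_eq[OF AB this] show ?thesis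
      by (rule LIMSEQ_le_const) auto
  qed
  have co: "completion_dist X A B = completion_dist X B A"
    if AB: "A \<in> completion_space X" "B \<in> completion_space X" for A B
  proof -
    obtain x y where xy: "x \<in> A" "y \<in> B" using AB completion_space_nonempty by blast
    show ?thesis
      using completion_dist_eq[OF AB xy] completion_dist_eq[OF AB(2,1) xy(2,1)]
      by (simp add: mdist_commute LIMSEQ_unique)
  qed
  fix A B C
  show "0 \<le> completion_dist X A B"
    using nn[of A B] by (cases "A \<in> completion_space X \<and> B \<in> completion_space X")
      (auto simp: completion_dist_def)
  show "completion_dist X A B = completion_dist X B A"
    using co[of A B] by (cases "A \<in> completion_space X \<and> B \<in> completion_space X")
      (auto simp: completion_dist_def)
  assume AB: "A \<in> completion_space X" "B \<in> completion_space X"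
  obtain x y where xy: "x \<in> A" "y \<in> B" using AB completion_space_nonempty by blast
  have cxy: "x \<in> Cauchy_seqs X" "y \<in> Cauchy_seqs X"
    using AB xy completion_space_subset by blast+
  note l = completion_dist_eq[OF AB xy]
  have "completion_dist X A B = 0 \<longleftrightarrow> (x, y) \<in> Cauchy_equiv X"
    using l LIMSEQ_unique cxy by (auto simp: Cauchy_equiv_def)
  also have "\<dots> \<longleftrightarrow> A = B"
    using quotient_eq_iff[OF equiv_Cauchy_equiv AB[unfolded completion_space_def] xy] by simp
  finally show "completion_dist X A B = 0 \<longleftrightarrow> A = B" .
  assume C: "C \<in> completion_space X"
  obtain z where z: "z \<in> C" using C completion_space_nonempty by blast
  have cz: "z \<in> Cauchy_seqs X" using C z completion_space_subset by blast
  show "completion_dist X A C \<le> completion_dist X A B + completion_dist X B C"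
    by (rule LIMSEQ_le[OF completion_dist_eq[OF AB(1) C xy(1) z]
          tendsto_add[OF l completion_dist_eq[OF AB(2) C xy(2) z]]])
      (auto intro!: mdist_triangle simp: cxy cz Cauchy_seqs_mspace)
qed

lemma mspace_Cauchy_completion: "mspace (Cauchy_completion X) = completion_space X"
  and mdist_Cauchy_completion: "mdist (Cauchy_completion X) = completion_dist X"
  unfolding Cauchy_completion_def
  by (simp_all add: Metric_space.mspace_metric Metric_space.mdist_metric Metric_space_completion)

section \<open>The spaces of finitely supported functions\<close>

text \<open>
  The ordinal \<open>s r \<le> \<omega>\<close> is an \<^typ>\<open>enat\<close>, with \<open>\<infinity>\<close> for \<open>\<omega>\<close>; as a set of smaller ordinals
  it is \<open>{k. enat k < s r}\<close>. The values of \<open>s\<close> outside \<open>V - {0}\<close> are irrelevant.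
\<close>

definition supp :: "real set \<Rightarrow> (real \<Rightarrow> nat) \<Rightarrow> real set" where
  "supp V f = {r \<in> V - {0}. f r \<noteq> 0}"

definition Fin_space :: "real set \<Rightarrow> (real \<Rightarrow> enat) \<Rightarrow> (real \<Rightarrow> nat) set" where
  "Fin_space V s = {f \<in> (\<Pi>\<^sub>E r\<in>V - {0}. {k. enat k < s r}). finite (supp V f)}"

text \<open>As for the completion, the value 0 outside the carrier only totalises the function.\<close>
definition Fin_dist :: "real set \<Rightarrow> (real \<Rightarrow> enat) \<Rightarrow> (real \<Rightarrow> nat) \<Rightarrow> (real \<Rightarrow> nat) \<Rightarrow> real" where
  "Fin_dist V s f g =
    (if f \<in> Fin_space V s \<and> g \<in> Fin_space V s \<and> f \<noteq> g
     then Max {r \<in> V - {0}. f r \<noteq> g r} else 0)"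

definition Fin_metric :: "real set \<Rightarrow> (real \<Rightarrow> enat) \<Rightarrow> (real \<Rightarrow> nat) metric" where
  "Fin_metric V s = metric (Fin_space V s, Fin_dist V s)"

lemma Fin_space_diff:
  assumes "f \<in> Fin_space V s" "g \<in> Fin_space V s"
  shows "finite {r \<in> V - {0}. f r \<noteq> g r}"
    and "f \<noteq> g \<Longrightarrow> {r \<in> V - {0}. f r \<noteq> g r} \<noteq> {}"
proof -
  have "{r \<in> V - {0}. f r \<noteq> g r} \<subseteq> supp V f \<union> supp V g"
    by (auto simp: supp_def)
  then show "finite {r \<in> V - {0}. f r \<noteq> g r}"
    using assms by (auto simp: Fin_space_def intro: finite_subset)
  show "{r \<in> V - {0}. f r \<noteq> g r} \<noteq> {}" if "f \<noteq> g"
  proof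
    assume "{r \<in> V - {0}. f r \<noteq> g r} = {}"
    then have "f = g"
      using assms by (intro PiE_ext[of f "V - {0}" _ g]) (auto simp: Fin_space_def)
    with that show False ..
  qed
qed

lemma Fin_dist_in:
  assumes "f \<in> Fin_space V s" "g \<in> Fin_space V s" "f \<noteq> g"
  shows "Fin_dist V s f g \<in> V - {0}" "f (Fin_dist V s f g) \<noteq> g (Fin_dist V s f g)"
  using Max_in[OF Fin_space_diff(1)[OF assms(1,2)] Fin_space_diff(2)[OF assms]] assms
  by (auto simp: Fin_dist_def)

lemma Fin_dist_ge:
  assumes "f \<in> Fin_space V s" "g \<in> Fin_space V s" "r \<in> V - {0}" "f r \<noteq> g r"
  shows "r \<le> Fin_dist V s f g"
  using Max_ge[OF Fin_space_diff(1)[OF assms(1,2)], of r] assms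
  by (auto simp: Fin_dist_def)

lemma Fin_dist_ultra:
  assumes V: "V \<subseteq> {0..}"
    and fgh: "f \<in> Fin_space V s" "g \<in> Fin_space V s" "h \<in> Fin_space V s"
  shows "Fin_dist V s f h \<le> max (Fin_dist V s f g) (Fin_dist V s g h)"
proof (cases "f = h")
  case True
  have "0 \<le> Fin_dist V s f g"
    using Fin_dist_in[OF fgh(1,2)] V by (cases "f = g") (auto simp: Fin_dist_def)
  with True show ?thesis by (simp add: Fin_dist_def)
next
  case False
  let ?r = "Fin_dist V s f h"
  have r: "?r \<in> V - {0}" "f ?r \<noteq> h ?r" using Fin_dist_in[OF fgh(1,3) False] by auto
  then consider "f ?r \<noteq> g ?r" | "g ?r \<noteq> h ?r" by metis
  then show ?thesis
    using Fin_dist_ge[OF fgh(1,2) r(1)] Fin_dist_ge[OF fgh(2,3) r(1)]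
    by cases (auto simp: le_max_iff_disj)
qed

lemma Metric_space_Fin:
  assumes V: "V \<subseteq> {0..}"
  shows "Metric_space (Fin_space V s) (Fin_dist V s)"
proof
  fix f g h
  show nn: "0 \<le> Fin_dist V s f g" for f g
    using Fin_dist_in[of f V s g] V
    by (cases "f \<in> Fin_space V s \<and> g \<in> Fin_space V s \<and> f \<noteq> g") (auto simp: Fin_dist_def)
  show "Fin_dist V s f g = Fin_dist V s g f"
    unfolding Fin_dist_def by (auto intro!: arg_cong[where f = Max])
  assume fg: "f \<in> Fin_space V s" "g \<in> Fin_space V s"
  show "Fin_dist V s f g = 0 \<longleftrightarrow> f = g"
    using Fin_dist_in(1)[OF fg] by (cases "f = g") (auto simp: Fin_dist_def)
  assume h: "h \<in> Fin_space V s"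
  show "Fin_dist V s f h \<le> Fin_dist V s f g + Fin_dist V s g h"
    using Fin_dist_ultra[OF V fg h] nn[of f g] nn[of g h] by linarith
qed

lemma mspace_Fin_metric: "V \<subseteq> {0..} \<Longrightarrow> mspace (Fin_metric V s) = Fin_space V s"
  and mdist_Fin_metric: "V \<subseteq> {0..} \<Longrightarrow> mdist (Fin_metric V s) = Fin_dist V s"
  unfolding Fin_metric_def
  by (simp_all add: Metric_space.mspace_metric Metric_space.mdist_metric Metric_space_Fin)

end

theory Submission
  imports Defs
begin

text \<open>
  The invariant of a point \<open>x\<close> in an ultrametric space is, for every \<open>r > 0\<close>, the number of open
  \<open>r\<close>-balls in the closed \<open>r\<close>-ball around \<open>x\<close>, measured by the sizes of the finite sets
  containing \<open>x\<close> with all distances equal to \<open>r\<close>. If these numbers agree at all points of two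
  complete separable ultrametric spaces, a back-and-forth argument along countable dense sets
  extends every finite partial isometry to an isometry of the spaces. In a homogeneous space
  the invariant does not depend on the point, and in the completion of \<open>M_s(Fin(V))\<close> it is
  \<open>s r\<close> if \<open>r \<in> V\<close> and 1 otherwise, so both implications follow.
\<close>

section \<open>Equilateral sets in ultrametric spaces\<close>

lemma mdist_self: "x \<in> mspace X \<Longrightarrow> mdist X x x = 0"
  by (simp add: mdist_zero)

text \<open>The side \<open>mdist X x y\<close> is too short to be the maximum in either strong
  triangle inequality, so the other two sides bound each other. This is the tool for replacing a
  point by a sufficiently near one without changing a distance.\<close>

lemma ultrametric_isosceles:
  assumes "ultrametric X" "x \<in> mspace X" "y \<in> mspace X" "z \<in> mspace X"
    and "mdist X x y < mdist X y z"
  shows "mdist X x z = mdist X y z"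
proof -
  have "mdist X x z \<le> max (mdist X x y) (mdist X y z)"
    "mdist X y z \<le> max (mdist X y x) (mdist X x z)"
    using assms unfolding ultrametric_def by blast+
  then show ?thesis
    using assms(5) mdist_commute[of X x y] by linarith
qed

lemma ultrametric_less:
  assumes "ultrametric X" "x \<in> mspace X" "y \<in> mspace X" "z \<in> mspace X"
    and "mdist X x y < r" "mdist X y z < r"
  shows "mdist X x z < r"
  using assms unfolding ultrametric_def by (meson le_less_trans max_less_iff_conj)

lemma ultrametric_le:
  assumes "ultrametric X" "x \<in> mspace X" "y \<in> mspace X" "z \<in> mspace X"
    and "mdist X x y \<le> r" "mdist X y z \<le> r"
  shows "mdist X x z \<le> r"
  using assms unfolding ultrametric_def by (meson order_trans max.bounded_iff)

definition equilateral :: "'a metric \<Rightarrow> real \<Rightarrow> 'a set \<Rightarrow> bool" where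
  "equilateral X r S \<longleftrightarrow>
    S \<subseteq> mspace X \<and> (\<forall>p\<in>S. \<forall>q\<in>S. p \<noteq> q \<longrightarrow> mdist X p q = r)"

lemma equilateral_insert:
  assumes "x \<in> mspace X" "equilateral X r S" "\<And>q. q \<in> S \<Longrightarrow> mdist X x q = r"
  shows "equilateral X r (insert x S)"
  using assms unfolding equilateral_def by (metis insert_iff insert_subset mdist_commute)

text \<open>Finite thresholds \<open>n\<close> stand in for a cardinal: infinitely many open
  \<open>r\<close>-balls means that every positive \<open>n\<close> is reached. As \<open>x\<close>
  is a vertex, \<open>n = 0\<close> never is.\<close>

definition has_simplex :: "'a metric \<Rightarrow> 'a \<Rightarrow> real \<Rightarrow> nat \<Rightarrow> bool" where
  "has_simplex X x r n \<longleftrightarrow>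
    (\<exists>S. finite S \<and> card S = n \<and> x \<in> S \<and> equilateral X r S)"

text \<open>\<open>S\<close> carries no metric here, so the same lemma serves isometries,
  approximations from a dense set and families indexed by numbers. Images at distance
  \<open>r > 0\<close> are distinct, which preserves the cardinality.\<close>

lemma has_simplex_image:
  assumes S: "finite S" "x \<in> S" and g: "g ` S \<subseteq> mspace Y" and r: "r > 0"
    and d: "\<And>p q. p \<in> S \<Longrightarrow> q \<in> S \<Longrightarrow> p \<noteq> q \<Longrightarrow> mdist Y (g p) (g q) = r"
  shows "has_simplex Y (g x) r (card S)"
proof -
  have inj: "inj_on g S"
  proof (rule inj_onI, rule ccontr)
    fix p q assume pq: "p \<in> S" "q \<in> S" "g p = g q" "p \<noteq> q"
    then have "mdist Y (g p) (g q) = 0"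
      using g by (metis image_subset_iff mdist_zero)
    then show False using d[OF pq(1,2,4)] r by simp
  qed
  show ?thesis
    unfolding has_simplex_def equilateral_def
    using S g d by (intro exI[of _ "g ` S"]) (auto simp: card_image[OF inj])
qed

lemma has_simplex_mono:
  assumes "has_simplex X x r n" "1 \<le> m" "m \<le> n"
  shows "has_simplex X x r m"
proof -
  obtain S where S: "finite S" "card S = n" "x \<in> S" "equilateral X r S"
    using assms(1) by (auto simp: has_simplex_def)
  have "m - 1 \<le> card (S - {x})" using S assms by simp
  then obtain T where T: "T \<subseteq> S - {x}" "card T = m - 1"
    by (rule obtain_subset_with_card_n)
  have "finite T" "x \<notin> T" using T S by (auto intro: finite_subset)
  then show ?thesis
    unfolding has_simplex_def using T S assms(2)
    by (intro exI[of _ "insert x T"]) (auto simp: equilateral_def)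
qed

text \<open>Moving each vertex by less than \<open>r\<close> does not affect distances equal to
  \<open>r\<close>, so simplices can be pushed into a dense isometric copy and back. The point
  \<open>x\<close> depends on \<open>y\<close> and \<open>r\<close> but not on
  \<open>n\<close>.\<close>

lemma has_simplex_dense:
  assumes Y: "ultrametric Y" and e: "e ` mspace X \<subseteq> mspace Y"
    and iso: "\<And>x x'. x \<in> mspace X \<Longrightarrow> x' \<in> mspace X \<Longrightarrow> mdist Y (e x) (e x') = mdist X x x'"
    and dense: "\<And>y \<epsilon>. y \<in> mspace Y \<Longrightarrow> \<epsilon> > 0 \<Longrightarrow> \<exists>x\<in>mspace X. mdist Y y (e x) < \<epsilon>"
    and r: "r > 0" and y: "y \<in> mspace Y"
  obtains x where "x \<in> mspace X" "\<And>n. has_simplex Y y r n \<longleftrightarrow> has_simplex X x r n"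
proof -
  obtain h where h: "\<And>z. z \<in> mspace Y \<Longrightarrow> h z \<in> mspace X \<and> mdist Y z (e (h z)) < r"
    using dense[OF _ r] by metis
  have "has_simplex X (h y) r n" if sim: "has_simplex Y y r n" for n
  proof -
    obtain S where S: "finite S" "card S = n" "y \<in> S" "equilateral Y r S"
      using sim by (auto simp: has_simplex_def)
    have SY: "S \<subseteq> mspace Y" using S by (auto simp: equilateral_def)
    have "mdist X (h p) (h q) = r" if pq: "p \<in> S" "q \<in> S" "p \<noteq> q" for p q
    proof -
      have m: "p \<in> mspace Y" "q \<in> mspace Y" "e (h p) \<in> mspace Y" "e (h q) \<in> mspace Y"
        "h p \<in> mspace X" "h q \<in> mspace X"
        using pq SY h e by auto
      have "mdist Y p q = r" using pq S by (auto simp: equilateral_def)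
      \<comment> \<open>The endpoints are moved one at a time, each by less than
        \<open>r\<close>.\<close>
      then have "mdist Y (e (h p)) q = r"
        using ultrametric_isosceles[OF Y m(3,1,2)] h[OF m(1)] by (simp add: mdist_commute)
      then have "mdist Y (e (h q)) (e (h p)) = r"
        using ultrametric_isosceles[OF Y m(4,2,3)] h[OF m(2)] by (simp add: mdist_commute)
      then show ?thesis using iso[OF m(5,6)] by (simp add: mdist_commute)
    qed
    then show ?thesis
      using has_simplex_image[OF S(1,3), of h X r] SY h r S(2) by blast
  qed
  moreover have "has_simplex Y y r n" if sim: "has_simplex X (h y) r n" for n
  proof -
    obtain S where S: "finite S" "card S = n" "h y \<in> S" "equilateral X r S"
      using sim by (auto simp: has_simplex_def)
    have SX: "S \<subseteq> mspace X" using S by (auto simp: equilateral_def)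
    \<comment> \<open>The base vertex goes to \<open>y\<close> itself and not to
      \<open>e (h y)\<close>, because the simplex in \<open>Y\<close> has to contain
      \<open>y\<close>.\<close>
    let ?g = "\<lambda>p. if p = h y then y else e p"
    have eY: "e p \<in> mspace Y" if "p \<in> S" for p using that SX e by auto
    have yq: "mdist Y y (e q) = r" if q: "q \<in> S" "q \<noteq> h y" for q
    proof -
      have "mdist Y (e (h y)) (e q) = r"
        using iso[of "h y" q] q S SX by (auto simp: equilateral_def)
      then show ?thesis
        using ultrametric_isosceles[OF Y y eY[OF S(3)] eY[OF q(1)]] h[OF y] by simp
    qed
    have "mdist Y (?g p) (?g q) = r" if "p \<in> S" "q \<in> S" "p \<noteq> q" for p q
      using yq that iso[of p q] S SX by (auto simp: equilateral_def mdist_commute)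
    moreover have "?g ` S \<subseteq> mspace Y" using eY y by auto
    ultimately show ?thesis
      using has_simplex_image[OF S(1,3), of ?g Y r] r S(2) by simp
  qed
  ultimately show ?thesis using that h[OF y] by blast
qed

section \<open>Back and forth\<close>

definition partial_isometry :: "'a metric \<Rightarrow> 'b metric \<Rightarrow> ('a \<times> 'b) set \<Rightarrow> bool" where
  "partial_isometry X Y R \<longleftrightarrow> R \<subseteq> mspace X \<times> mspace Y \<and>
    (\<forall>x y x' y'. (x, y) \<in> R \<longrightarrow> (x', y') \<in> R \<longrightarrow> mdist X x x' = mdist Y y y')"

lemma partial_isometry_converse:
  "partial_isometry Y X (R\<inverse>) \<longleftrightarrow> partial_isometry X Y R"
  unfolding partial_isometry_def by (auto 4 4)

lemma partial_isometry_insert: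
  assumes "partial_isometry X Y R" "x \<in> mspace X" "y \<in> mspace Y"
    and "\<And>a b. (a, b) \<in> R \<Longrightarrow> mdist X x a = mdist Y y b"
  shows "partial_isometry X Y (insert (x, y) R)"
  using assms unfolding partial_isometry_def by (auto simp: mdist_commute mdist_self)

text \<open>
  The new point is placed relative to the points \<open>a\<close> nearest to \<open>x\<close>, at distance \<open>r\<close>. A maximal
  \<open>r\<close>-equilateral set \<open>T\<close> of those meets all open \<open>r\<close>-balls that they occupy and becomes larger by
  adding \<open>x\<close>, so its image also leaves an \<open>r\<close>-ball unoccupied.
\<close>
lemma partial_isometry_extend:
  assumes X: "ultrametric X" and Y: "ultrametric Y" and ne: "mspace Y \<noteq> {}"
    and sim: "\<And>x y r n. x \<in> mspace X \<Longrightarrow> y \<in> mspace Y \<Longrightarrow> r > 0 \<Longrightarrow>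
      has_simplex X x r n \<Longrightarrow> has_simplex Y y r n"
    and R: "partial_isometry X Y R" "finite R" and x: "x \<in> mspace X"
  shows "\<exists>y. partial_isometry X Y (insert (x, y) R)"
proof -
  have RX: "a \<in> mspace X" "b \<in> mspace Y" if "(a, b) \<in> R" for a b
    using R(1) that by (auto simp: partial_isometry_def)
  have Rd: "mdist X a a' = mdist Y b b'" if "(a, b) \<in> R" "(a', b') \<in> R" for a b a' b'
    using R(1) that unfolding partial_isometry_def by blast
  consider "R = {}" | y where "(x, y) \<in> R" | "R \<noteq> {}" "x \<notin> Domain R" by blast
  then show ?thesis
  proof cases
    case 1
    then show ?thesis using ne x by (auto simp: partial_isometry_def mdist_self)
  next
    case 2
    then show ?thesis using R(1) by (metis insert_absorb)
  next
    case 3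
    obtain p0 where p0: "p0 \<in> R" "\<And>p. p \<in> R \<Longrightarrow> mdist X x (fst p0) \<le> mdist X x (fst p)"
      using ex_min_if_finite[of "(\<lambda>p. mdist X x (fst p)) ` R"] R(2) 3(1)
      by (auto simp: not_less)
    obtain a0 b0 where "p0 = (a0, b0)" by (cases p0)
    with p0 have p: "(a0, b0) \<in> R"
      and min: "\<And>a b. (a, b) \<in> R \<Longrightarrow> mdist X x a0 \<le> mdist X x a"
      by auto
    define r where "r = mdist X x a0"
    have r: "r > 0"
      using p 3(2) RX[OF p] x mdist_nonneg[of X x a0] mdist_zero[OF x RX(1)[OF p]]
      unfolding r_def by (metis Domain.DomainI order_le_less)
    define R0 where "R0 = {(a, b) \<in> R. mdist X x a = r}"
    define F where "F = {T. T \<subseteq> R0 \<and> (\<forall>p\<in>T. \<forall>q\<in>T. p \<noteq> q \<longrightarrow> mdist X (fst p) (fst q) = r)}"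
    have "finite R0" by (rule finite_subset[OF _ R(2)]) (auto simp: R0_def)
    then have "finite F"
      by (intro finite_subset[of F "Pow R0"]) (auto simp: F_def)
    moreover have "{} \<in> F" by (simp add: F_def)
    ultimately obtain T where T: "T \<in> F" and max: "\<And>T'. T' \<in> F \<Longrightarrow> T \<subseteq> T' \<Longrightarrow> T = T'"
      using finite_has_maximal2[of F "{}"] by blast
    have TR0: "T \<subseteq> R0" and Td: "\<And>p q. p \<in> T \<Longrightarrow> q \<in> T \<Longrightarrow> p \<noteq> q \<Longrightarrow> mdist X (fst p) (fst q) = r"
      using T by (auto simp: F_def)
    have finT: "finite T" using TR0 \<open>finite R0\<close> finite_subset by blast
    have TX: "fst p \<in> mspace X" "snd p \<in> mspace Y" "mdist X x (fst p) = r" if "p \<in> T" for p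
      using that TR0 RX[of "fst p" "snd p"] by (auto simp: R0_def)
    have "inj_on fst T"
      using Td TX r by (intro inj_onI) (metis less_irrefl mdist_self)
    moreover have "x \<notin> fst ` T"
      using TX r x by (metis imageE less_irrefl mdist_self)
    ultimately have "card (insert x (fst ` T)) = Suc (card T)"
      using finT by (simp add: card_image)
    moreover have "equilateral X r (insert x (fst ` T))"
    proof (rule equilateral_insert[OF x])
      have "mdist X a b = r" if ab: "a \<in> fst ` T" "b \<in> fst ` T" "a \<noteq> b" for a b
      proof -
        obtain p q where "p \<in> T" "q \<in> T" "a = fst p" "b = fst q" using ab by blast
        then show ?thesis using Td[of p q] ab(3) by blast
      qed
      then show "equilateral X r (fst ` T)"
        unfolding equilateral_def using TX(1) by (simp add: image_subset_iff)
      show "mdist X x q = r" if "q \<in> fst ` T" for q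
        using that TX(3) by blast
    qed
    ultimately have "has_simplex X x r (Suc (card T))"
      using finT unfolding has_simplex_def
      by (metis finite_imageI finite_insert insertI1)
    \<comment> \<open>Basing the simplex at \<open>b0\<close> keeps all its vertices within
      \<open>r\<close> of \<open>b0\<close>; this later bounds the distances from the new
      point.\<close>
    then have "has_simplex Y b0 r (Suc (card T))"
      using sim[OF x RX(2)[OF p] r] by blast
    then obtain S where S: "finite S" "card S = Suc (card T)" "b0 \<in> S" "equilateral Y r S"
      by (auto simp: has_simplex_def)
    have SY: "S \<subseteq> mspace Y" and Sd: "\<And>u v. u \<in> S \<Longrightarrow> v \<in> S \<Longrightarrow> u \<noteq> v \<Longrightarrow> mdist Y u v = r"
      using S(4) by (auto simp: equilateral_def)
    \<comment> \<open>Pigeonhole: if every vertex of \<open>S\<close> were in the open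
      \<open>r\<close>-ball of an image point of \<open>T\<close>, two of the
      \<open>Suc (card T)\<close> vertices would share one and be closer than
      \<open>r\<close>.\<close>
    have "\<exists>u\<in>S. \<forall>p\<in>T. r \<le> mdist Y u (snd p)"
    proof (rule ccontr)
      assume "\<not> ?thesis"
      then have "\<forall>u\<in>S. \<exists>p\<in>T. mdist Y u (snd p) < r" by (auto simp: not_le)
      then obtain \<phi> where \<phi>: "\<And>u. u \<in> S \<Longrightarrow> \<phi> u \<in> T \<and> mdist Y u (snd (\<phi> u)) < r"
        by metis
      have "inj_on \<phi> S"
      proof (rule inj_onI, rule ccontr)
        fix u v assume uv: "u \<in> S" "v \<in> S" "\<phi> u = \<phi> v" "u \<noteq> v"
        have "mdist Y u v < r"
          using ultrametric_less[OF Y, of u "snd (\<phi> u)" v r] \<phi>[OF uv(1)] \<phi>[OF uv(2)] uv SY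
            TX(2)[of "\<phi> u"] by (auto simp: mdist_commute)
        then show False using Sd[OF uv(1,2,4)] by simp
      qed
      then have "card S \<le> card T"
        using \<phi> finT by (intro card_inj_on_le[of \<phi>]) auto
      then show False using S(2) by simp
    qed
    then obtain u where u: "u \<in> S" "\<And>p. p \<in> T \<Longrightarrow> r \<le> mdist Y u (snd p)" by blast
    have uY: "u \<in> mspace Y" using u SY by blast
    have ub0: "mdist Y u b0 \<le> r"
      using Sd[OF u(1) S(3)] r mdist_self[OF subsetD[OF SY S(3)]] by (cases "u = b0") auto
    \<comment> \<open>The upper bound \<open>r\<close> comes through \<open>b0\<close> for all of
      \<open>R0\<close>. The lower bound comes from the choice of \<open>u\<close> on
      \<open>T\<close>, and from maximality of \<open>T\<close> elsewhere.\<close>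
    have R0d: "mdist Y u b = r" if ab: "(a, b) \<in> R0" for a b
    proof -
      have abR: "(a, b) \<in> R" "mdist X x a = r" using ab by (auto simp: R0_def)
      have near: "mdist Y u b' \<le> r" if "(a', b') \<in> R0" for a' b'
      proof -
        have a'R: "(a', b') \<in> R" "mdist X x a' = r" using that by (auto simp: R0_def)
        have "mdist X a0 a' \<le> r"
          using ultrametric_le[OF X, of a0 x a' r] a'R RX[OF a'R(1)] RX[OF p] x
          by (simp add: r_def mdist_commute)
        then have "mdist Y b0 b' \<le> r" using Rd[OF p a'R(1)] by simp
        then show ?thesis
          using ultrametric_le[OF Y uY RX(2)[OF p] RX(2)[OF a'R(1)] ub0] by simp
      qed
      have onT: "mdist Y u (snd p) = r" if "p \<in> T" for p
        using u(2)[OF that] near[of "fst p" "snd p"] that TR0 by force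
      show ?thesis
      proof (cases "(a, b) \<in> T")
        case True
        then show ?thesis using onT by force
      next
        case False
        \<comment> \<open>By maximality \<open>a\<close> is closer than \<open>r\<close> to some
          \<open>a'\<close> with \<open>(a', b')\<close> in \<open>T\<close>. Then \<open>b\<close>
          is equally close to \<open>b'\<close> and has the same distance from
          \<open>u\<close>.\<close>
        then have "insert (a, b) T \<notin> F" using max by blast
        then obtain q where q: "q \<in> T" "mdist X a (fst q) \<noteq> r"
          using Td ab TR0 unfolding F_def by (auto simp: mdist_commute)
        obtain a' b' where q': "q = (a', b')" "(a', b') \<in> R" "mdist X x a' = r"
          using q(1) TR0 by (auto simp: R0_def)
        have "mdist X a a' \<le> r"
          using ultrametric_le[OF X, of a x a' r] q' abR RX[OF abR(1)] RX[OF q'(2)] x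
          by (simp add: mdist_commute)
        then have "mdist Y b b' < r"
          using q q' Rd[OF abR(1) q'(2)] by simp
        moreover have "mdist Y u b' = r" using onT[OF q(1)] q' by simp
        ultimately show ?thesis
          using ultrametric_isosceles[OF Y RX(2)[OF abR(1)] RX(2)[OF q'(2)] uY]
          by (simp add: mdist_commute)
      qed
    qed
    have "mdist X x a = mdist Y u b" if ab: "(a, b) \<in> R" for a b
    proof (cases "mdist X x a = r")
      case True
      then show ?thesis using R0d[of a b] ab by (simp add: R0_def)
    next
      case False
      \<comment> \<open>A point farther from \<open>x\<close> than \<open>r\<close> has equal
        distances from \<open>x\<close> and \<open>a0\<close>, and its image has equal distances
        from \<open>u\<close> and \<open>b0\<close>.\<close>
      then have gt: "r < mdist X x a" using min[OF ab] by (simp add: r_def)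
      have 1: "mdist X a0 a = mdist X x a"
        using ultrametric_isosceles[OF X RX(1)[OF p] x RX(1)[OF ab]] gt
        by (simp add: r_def mdist_commute)
      then have "mdist Y u b0 < mdist Y b0 b" using Rd[OF p ab] gt ub0 by simp
      then have "mdist Y u b = mdist Y b0 b"
        by (rule ultrametric_isosceles[OF Y uY RX(2)[OF p] RX(2)[OF ab]])
      then show ?thesis using 1 Rd[OF p ab] by simp
    qed
    then show ?thesis using partial_isometry_insert[OF R(1) x uY] by blast
  qed
qed


section \<open>Separability and completeness in terms of distances\<close>

lemma separable_space_mtopology_of:
  "separable_space (mtopology_of X) \<longleftrightarrow>
    (\<exists>D. countable D \<and> D \<subseteq> mspace X \<and> (\<forall>x\<in>mspace X. \<forall>\<epsilon>>0. \<exists>d\<in>D. mdist X x d < \<epsilon>))"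
proof -
  interpret Metric_space "mspace X" "mdist X" by (rule Metric_space_mspace_mdist)
  have "mtopology closure_of D = topspace mtopology \<longleftrightarrow>
      (\<forall>x\<in>mspace X. \<forall>\<epsilon>>0. \<exists>d\<in>D. mdist X x d < \<epsilon>)" if "D \<subseteq> mspace X" for D
    using that unfolding metric_closure_of by (auto simp: subset_iff)
  then show ?thesis
    by (auto simp: separable_space_def mtopology_of_def)
qed

lemma mcomplete_of_iff:
  "mcomplete_of X \<longleftrightarrow>
    (\<forall>x\<in>Cauchy_seqs X. \<exists>l\<in>mspace X. (\<lambda>n. mdist X (x n) l) \<longlonglongrightarrow> 0)"
proof -
  interpret Metric_space "mspace X" "mdist X" by (rule Metric_space_mspace_mdist)
  have "limitin mtopology x l sequentially \<longleftrightarrow> l \<in> mspace X \<and> (\<lambda>n. mdist X (x n) l) \<longlonglongrightarrow> 0"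
    if "x \<in> Cauchy_seqs X" for x l
    using Cauchy_seqs_mspace[OF that] by (simp add: limit_metric_sequentially lim_sequentially)
  then show ?thesis
    unfolding mcomplete_of_def mcomplete_def Cauchy_seqs_def by blast
qed

lemma Cauchy_seqsI:
  assumes "\<And>n. x n \<in> mspace X"
    and "\<And>\<epsilon>. \<epsilon> > 0 \<Longrightarrow> \<exists>N. \<forall>n\<ge>N. \<forall>m\<ge>N. mdist X (x n) (x m) < \<epsilon>"
  shows "x \<in> Cauchy_seqs X"
  using assms Metric_space.MCauchy_def[OF Metric_space_mspace_mdist, of X x]
  unfolding Cauchy_seqs_def by blast

section \<open>Back-and-forth along countable dense sets\<close>

text \<open>Stage \<open>n\<close> adds the \<open>n\<close>-th points of the dense sets
  \<open>D\<close> and \<open>E\<close> to the domain and range. Each stage is finite, so one-point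
  extension applies again; the union of the increasing stages is \<open>Q\<close>, and any two of
  its pairs lie in a common stage.\<close>

lemma dense_partial_isometry:
  assumes ultra: "ultrametric X" "ultrametric Y" and ne: "mspace X \<noteq> {}" "mspace Y \<noteq> {}"
    and sep: "separable_space (mtopology_of X)" "separable_space (mtopology_of Y)"
    and sim: "\<And>x y r n. x \<in> mspace X \<Longrightarrow> y \<in> mspace Y \<Longrightarrow> r > 0 \<Longrightarrow>
      has_simplex X x r n \<longleftrightarrow> has_simplex Y y r n"
    and R: "partial_isometry X Y R" "finite R"
  obtains Q where "partial_isometry X Y Q" "R \<subseteq> Q"
    "\<And>x \<epsilon>. x \<in> mspace X \<Longrightarrow> \<epsilon> > 0 \<Longrightarrow> \<exists>p\<in>Q. mdist X x (fst p) < \<epsilon>"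
    "\<And>y \<epsilon>. y \<in> mspace Y \<Longrightarrow> \<epsilon> > 0 \<Longrightarrow> \<exists>p\<in>Q. mdist Y y (snd p) < \<epsilon>"
proof -
  obtain D where D: "countable D" "D \<subseteq> mspace X"
    "\<And>x \<epsilon>. x \<in> mspace X \<Longrightarrow> \<epsilon> > 0 \<Longrightarrow> \<exists>d\<in>D. mdist X x d < \<epsilon>"
    using sep(1) by (auto simp: separable_space_mtopology_of)
  obtain E where E: "countable E" "E \<subseteq> mspace Y"
    "\<And>y \<epsilon>. y \<in> mspace Y \<Longrightarrow> \<epsilon> > 0 \<Longrightarrow> \<exists>d\<in>E. mdist Y y d < \<epsilon>"
    using sep(2) by (auto simp: separable_space_mtopology_of)
  have neD: "D \<noteq> {}" and neE: "E \<noteq> {}"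
    using D(3) E(3) ne zero_less_one by blast+
  have Dn: "from_nat_into D n \<in> mspace X" and En: "from_nat_into E n \<in> mspace Y" for n
    using from_nat_into[OF neD] from_nat_into[OF neE] D(2) E(2) by auto
  let ?P = "\<lambda>n P. R \<subseteq> P \<and> finite P \<and> partial_isometry X Y P"
  let ?S = "\<lambda>n P P'. P \<subseteq> P' \<and> from_nat_into D n \<in> Domain P' \<and> from_nat_into E n \<in> Range P'"
  have "\<exists>f. \<forall>n. ?P n (f n) \<and> ?S n (f n) (f (Suc n))"
  proof (rule dependent_nat_choice)
    show "\<exists>P. R \<subseteq> P \<and> finite P \<and> partial_isometry X Y P" using R by blast
    fix P n assume P: "R \<subseteq> P \<and> finite P \<and> partial_isometry X Y P"
    obtain y where y: "partial_isometry X Y (insert (from_nat_into D n, y) P)" (is "partial_isometry X Y ?P'")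
      using partial_isometry_extend[OF ultra ne(2) _ _ _ Dn, of P] sim P by blast
    \<comment> \<open>The back step is the forth step for the converse relation, with the roles of
      \<open>X\<close> and \<open>Y\<close> exchanged.\<close>
    have "\<exists>x. partial_isometry Y X (insert (from_nat_into E n, x) (?P'\<inverse>))"
    proof (rule partial_isometry_extend[OF ultra(2,1) ne(1) _ _ _ En])
      show "partial_isometry Y X (?P'\<inverse>)" using y by (simp only: partial_isometry_converse)
      show "finite (?P'\<inverse>)" using P by simp
    qed (use sim in blast)
    then obtain x where "partial_isometry Y X (insert (from_nat_into E n, x) (?P'\<inverse>))" by blast
    moreover have "insert (from_nat_into E n, x) (?P'\<inverse>) = (insert (x, from_nat_into E n) ?P')\<inverse>"
      by auto
    ultimately have "partial_isometry X Y (insert (x, from_nat_into E n) ?P')"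
      by (simp only: partial_isometry_converse)
    then show "\<exists>Q. (R \<subseteq> Q \<and> finite Q \<and> partial_isometry X Y Q) \<and> ?S n P Q"
      using P by (intro exI[of _ "insert (x, from_nat_into E n) ?P'"]) auto
  qed
  then obtain f where f: "\<And>n. ?P n (f n)" "\<And>n. ?S n (f n) (f (Suc n))" by blast
  have mono: "f m \<subseteq> f n" if "m \<le> n" for m n
    by (rule lift_Suc_mono_le[OF _ that]) (use f in blast)
  define Q where "Q = (\<Union>n. f n)"
  have "partial_isometry X Y Q"
    unfolding partial_isometry_def
  proof (intro conjI allI impI)
    show "Q \<subseteq> mspace X \<times> mspace Y" using f(1) by (auto simp: Q_def partial_isometry_def)
    fix x y x' y' assume "(x, y) \<in> Q" "(x', y') \<in> Q"
    then obtain m n where "(x, y) \<in> f m" "(x', y') \<in> f n" by (auto simp: Q_def)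
    then have "(x, y) \<in> f (max m n)" "(x', y') \<in> f (max m n)"
      using mono[of m "max m n"] mono[of n "max m n"] by auto
    then show "mdist X x x' = mdist Y y y'"
      using f(1)[of "max m n"] unfolding partial_isometry_def by blast
  qed
  moreover have "R \<subseteq> Q" using f(1) by (auto simp: Q_def)
  moreover have "\<exists>p\<in>Q. mdist X x (fst p) < \<epsilon>" if close: "x \<in> mspace X" "\<epsilon> > 0" for x \<epsilon>
  proof -
    obtain d where d: "d \<in> D" "mdist X x d < \<epsilon>" using D(3)[OF close] by blast
    then obtain n where "from_nat_into D n = d"
      using from_nat_into_surj[OF D(1)] by blast
    then obtain b where "(d, b) \<in> f (Suc n)" using f(2)[of n] by auto
    then show ?thesis using d(2) by (intro bexI[of _ "(d, b)"]) (auto simp: Q_def)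
  qed
  moreover have "\<exists>p\<in>Q. mdist Y y (snd p) < \<epsilon>" if close: "y \<in> mspace Y" "\<epsilon> > 0" for y \<epsilon>
  proof -
    obtain d where d: "d \<in> E" "mdist Y y d < \<epsilon>" using E(3)[OF close] by blast
    then obtain n where "from_nat_into E n = d"
      using from_nat_into_surj[OF E(1)] by blast
    then obtain a where "(a, d) \<in> f (Suc n)" using f(2)[of n] by auto
    then show ?thesis using d(2) by (intro bexI[of _ "(a, d)"]) (auto simp: Q_def)
  qed
  ultimately show ?thesis using that by blast
qed

section \<open>Passing from dense relations to the complete spaces\<close>

text \<open>The closure of \<open>Q\<close> in the product space: one pair of \<open>Q\<close>
  approximates both coordinates at once. The relational form is symmetric in \<open>X\<close> and
  \<open>Y\<close>, so surjectivity of the limit map follows from its totality.\<close>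

definition closure_rel :: "'a metric \<Rightarrow> 'b metric \<Rightarrow> ('a \<times> 'b) set \<Rightarrow> ('a \<times> 'b) set" where
  "closure_rel X Y Q = {(x, y). x \<in> mspace X \<and> y \<in> mspace Y \<and>
    (\<forall>\<epsilon>>0. \<exists>p\<in>Q. mdist X x (fst p) < \<epsilon> \<and> mdist Y y (snd p) < \<epsilon>)}"

lemma closure_rel_converse: "closure_rel Y X (Q\<inverse>) = (closure_rel X Y Q)\<inverse>"
proof -
  have "(\<exists>p\<in>Q\<inverse>. mdist Y y (fst p) < \<epsilon> \<and> mdist X x (snd p) < \<epsilon>) \<longleftrightarrow>
      (\<exists>p\<in>Q. mdist X x (fst p) < \<epsilon> \<and> mdist Y y (snd p) < \<epsilon>)" for x y \<epsilon>
    by force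
  then show ?thesis unfolding closure_rel_def by auto
qed

text \<open>Four approximations within \<open>\<epsilon>/4\<close> change the two distances by less
  than \<open>\<epsilon>\<close> altogether.\<close>

lemma partial_isometry_closure_rel:
  assumes Q: "partial_isometry X Y Q"
  shows "partial_isometry X Y (closure_rel X Y Q)"
  unfolding partial_isometry_def
proof (intro conjI allI impI)
  show "closure_rel X Y Q \<subseteq> mspace X \<times> mspace Y" by (auto simp: closure_rel_def)
  fix x y x' y' assume xy: "(x, y) \<in> closure_rel X Y Q" and xy': "(x', y') \<in> closure_rel X Y Q"
  have m: "x \<in> mspace X" "y \<in> mspace Y" "x' \<in> mspace X" "y' \<in> mspace Y"
    using xy xy' by (auto simp: closure_rel_def)
  have "\<bar>mdist X x x' - mdist Y y y'\<bar> \<le> \<epsilon>" if "\<epsilon> > 0" for \<epsilon>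
  proof -
    have "\<epsilon>/4 > 0" using that by simp
    then obtain a b where ab: "(a, b) \<in> Q" "mdist X x a < \<epsilon>/4" "mdist Y y b < \<epsilon>/4"
      using xy unfolding closure_rel_def by fastforce
    obtain a' b' where ab': "(a', b') \<in> Q" "mdist X x' a' < \<epsilon>/4" "mdist Y y' b' < \<epsilon>/4"
      using xy' \<open>\<epsilon>/4 > 0\<close> unfolding closure_rel_def by fastforce
    have "mdist X a a' = mdist Y b b'" using Q ab ab' unfolding partial_isometry_def by blast
    moreover have "a \<in> mspace X" "b \<in> mspace Y" "a' \<in> mspace X" "b' \<in> mspace Y"
      using Q ab ab' unfolding partial_isometry_def by auto
    ultimately show ?thesis
      using mdist_quadrilateral[of x X x' a a'] mdist_quadrilateral[of y Y y' b b'] ab ab' m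
      by (simp add: abs_le_iff abs_less_iff)
  qed
  then show "mdist X x x' = mdist Y y y'"
    using field_le_epsilon[of "\<bar>mdist X x x' - mdist Y y y'\<bar>" 0] by simp
qed

text \<open>Pairs of \<open>Q\<close> whose first coordinates tend to \<open>x\<close> have Cauchy
  second coordinates, since \<open>Q\<close> preserves distances. Completeness of \<open>Y\<close>
  provides the partner of \<open>x\<close>.\<close>

lemma Domain_closure_rel:
  assumes Q: "partial_isometry X Y Q"
    and dense: "\<And>x \<epsilon>. x \<in> mspace X \<Longrightarrow> \<epsilon> > 0 \<Longrightarrow> \<exists>p\<in>Q. mdist X x (fst p) < \<epsilon>"
    and Y: "mcomplete_of Y" and x: "x \<in> mspace X"
  shows "x \<in> Domain (closure_rel X Y Q)"
proof -
  have "\<exists>p\<in>Q. mdist X x (fst p) < 1 / real (Suc n)" for n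
    by (rule dense[OF x]) simp
  then obtain p where p: "\<And>n. p n \<in> Q" "\<And>n. mdist X x (fst (p n)) < 1 / real (Suc n)"
    by metis
  have pm: "fst (p n) \<in> mspace X" "snd (p n) \<in> mspace Y" for n
    using p(1)[of n] Q by (auto simp: partial_isometry_def)
  have pd: "mdist X (fst (p n)) (fst (p m)) = mdist Y (snd (p n)) (snd (p m))" for m n
    using p(1)[of n] p(1)[of m] Q unfolding partial_isometry_def by (metis prod.collapse)
  have lim: "(\<lambda>n. mdist X x (fst (p n))) \<longlonglongrightarrow> 0"
    by (rule tendsto_sandwich[OF _ _ tendsto_const LIMSEQ_inverse_real_of_nat])
      (use p(2) in \<open>auto intro!: always_eventually less_imp_le simp: inverse_eq_divide\<close>)
  have "(\<lambda>n. snd (p n)) \<in> Cauchy_seqs Y"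
  proof (rule Cauchy_seqsI)
    fix \<epsilon> :: real assume "\<epsilon> > 0"
    then have "\<epsilon>/2 > 0" by simp
    then obtain N where N: "\<And>n. n \<ge> N \<Longrightarrow> mdist X x (fst (p n)) < \<epsilon>/2"
      using order_tendstoD(2)[OF lim] unfolding eventually_sequentially by blast
    have "mdist Y (snd (p n)) (snd (p m)) < \<epsilon>" if "n \<ge> N" "m \<ge> N" for n m
      using N[OF that(1)] N[OF that(2)] mdist_triangle[of "fst (p n)" X x "fst (p m)"] pm x pd[of n m]
        mdist_commute[of X x "fst (p n)"] by auto
    then show "\<exists>N. \<forall>n\<ge>N. \<forall>m\<ge>N. mdist Y (snd (p n)) (snd (p m)) < \<epsilon>" by blast
  qed (rule pm)
  then obtain y where y: "y \<in> mspace Y" and limy: "(\<lambda>n. mdist Y (snd (p n)) y) \<longlonglongrightarrow> 0"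
    using Y by (auto simp: mcomplete_of_iff)
  have "\<exists>p\<in>Q. mdist X x (fst p) < \<epsilon> \<and> mdist Y y (snd p) < \<epsilon>" if "\<epsilon> > 0" for \<epsilon>
  proof -
    have "\<forall>\<^sub>F n in sequentially. mdist X x (fst (p n)) < \<epsilon> \<and> mdist Y (snd (p n)) y < \<epsilon>"
      using order_tendstoD(2)[OF lim that] order_tendstoD(2)[OF limy that]
      by (rule eventually_conj)
    then obtain n where "mdist X x (fst (p n)) < \<epsilon>" "mdist Y (snd (p n)) y < \<epsilon>"
      using eventually_happens'[OF sequentially_bot] by blast
    then show ?thesis
      using p(1)[of n] mdist_commute[of Y y "snd (p n)"] by (intro bexI[of _ "p n"]) auto
  qed
  then show ?thesis using x y by (auto simp: closure_rel_def)
qed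

lemma partial_isometry_functional:
  assumes "partial_isometry X Y R" "(x, y) \<in> R" "(x, y') \<in> R"
  shows "y = y'"
proof -
  have "mdist Y y y' = mdist X x x" "x \<in> mspace X" "y \<in> mspace Y" "y' \<in> mspace Y"
    using assms unfolding partial_isometry_def by (metis, auto)
  then show ?thesis by (simp add: mdist_self mdist_zero)
qed

text \<open>The closure of the back-and-forth relation is the graph of \<open>g\<close>. With
  \<open>R\<close> the graph of a finite isometry this yields homogeneity, with \<open>R\<close>
  empty an isometry between two spaces.\<close>

lemma extend_partial_isometry:
  assumes ultra: "ultrametric X" "ultrametric Y" and ne: "mspace X \<noteq> {}" "mspace Y \<noteq> {}"
    and sep: "separable_space (mtopology_of X)" "separable_space (mtopology_of Y)"
    and complete: "mcomplete_of X" "mcomplete_of Y"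
    and sim: "\<And>x y r n. x \<in> mspace X \<Longrightarrow> y \<in> mspace Y \<Longrightarrow> r > 0 \<Longrightarrow>
      has_simplex X x r n \<longleftrightarrow> has_simplex Y y r n"
    and R: "partial_isometry X Y R" "finite R"
  obtains g where "isometry_onto X Y g" "\<And>x y. (x, y) \<in> R \<Longrightarrow> g x = y"
proof -
  obtain Q where Q: "partial_isometry X Y Q" "R \<subseteq> Q"
    and dense: "\<And>x \<epsilon>. x \<in> mspace X \<Longrightarrow> \<epsilon> > 0 \<Longrightarrow> \<exists>p\<in>Q. mdist X x (fst p) < \<epsilon>"
      "\<And>y \<epsilon>. y \<in> mspace Y \<Longrightarrow> \<epsilon> > 0 \<Longrightarrow> \<exists>p\<in>Q. mdist Y y (snd p) < \<epsilon>"
    by (rule dense_partial_isometry[OF ultra ne sep _ R]) (use sim in blast)+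
  let ?C = "closure_rel X Y Q"
  note C = partial_isometry_closure_rel[OF Q(1)]
  have CX: "x \<in> Domain ?C" if "x \<in> mspace X" for x
    using Domain_closure_rel[OF Q(1) dense(1) complete(2) that] .
  \<comment> \<open>Surjectivity is totality of the converse relation, this time from completeness
    of \<open>X\<close>.\<close>
  have CY: "y \<in> Range ?C" if "y \<in> mspace Y" for y
  proof -
    have "y \<in> Domain (closure_rel Y X (Q\<inverse>))"
    proof (rule Domain_closure_rel[OF _ _ complete(1) that])
      show "partial_isometry Y X (Q\<inverse>)" using Q(1) by (simp only: partial_isometry_converse)
      show "\<exists>p\<in>Q\<inverse>. mdist Y y (fst p) < \<epsilon>" if "y \<in> mspace Y" "\<epsilon> > 0" for y \<epsilon>
        using dense(2)[OF that] by force
    qed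
    then show ?thesis by (simp add: closure_rel_converse)
  qed
  obtain g where g: "\<And>x. x \<in> mspace X \<Longrightarrow> (x, g x) \<in> ?C"
    using CX unfolding Domain_iff by metis
  have geq: "g x = y" if "(x, y) \<in> ?C" for x y
    using partial_isometry_functional[OF C g that] that C by (auto simp: partial_isometry_def)
  have "isometry_onto X Y g"
    unfolding isometry_onto_def
  proof (intro conjI ballI set_eqI iffI)
    fix y assume "y \<in> g ` mspace X"
    then show "y \<in> mspace Y" using g by (auto simp: closure_rel_def)
  next
    fix y assume "y \<in> mspace Y"
    then obtain x where "(x, y) \<in> ?C" using CY by blast
    then show "y \<in> g ` mspace X" using geq C by (force simp: partial_isometry_def)
  next
    fix x x' assume "x \<in> mspace X" "x' \<in> mspace X"
    then show "mdist Y (g x) (g x') = mdist X x x'"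
      using g C unfolding partial_isometry_def by metis
  qed
  moreover have "g x = y" if "(x, y) \<in> R" for x y
  proof (rule geq)
    have "(x, y) \<in> Q" "x \<in> mspace X" "y \<in> mspace Y"
      using that Q by (auto simp: partial_isometry_def)
    then show "(x, y) \<in> ?C"
      unfolding closure_rel_def by (auto simp: mdist_self intro!: bexI[of _ "(x, y)"])
  qed
  ultimately show ?thesis using that by blast
qed


section \<open>Homogeneity\<close>

lemma homogeneousI:
  assumes X: "ultrametric X" "mspace X \<noteq> {}" "separable_space (mtopology_of X)" "mcomplete_of X"
    and sim: "\<And>x y r n. x \<in> mspace X \<Longrightarrow> y \<in> mspace X \<Longrightarrow> r > 0 \<Longrightarrow>
      has_simplex X x r n \<longleftrightarrow> has_simplex X y r n"
  shows "homogeneous X"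
  unfolding homogeneous_def
proof (intro allI impI)
  fix A B f
  assume "finite A \<and> A \<subseteq> mspace X \<and> finite B \<and> B \<subseteq> mspace X \<and>
    isometry_onto (submetric X A) (submetric X B) f"
  then have A: "finite A" "A \<subseteq> mspace X" and B: "f ` A = B" "B \<subseteq> mspace X"
    and d: "\<And>x y. x \<in> A \<Longrightarrow> y \<in> A \<Longrightarrow> mdist X (f x) (f y) = mdist X x y"
    by (auto simp: isometry_onto_def Int_absorb2)
  let ?R = "(\<lambda>x. (x, f x)) ` A"
  have R: "partial_isometry X X ?R" "finite ?R"
    using A B d by (auto simp: partial_isometry_def)
  obtain g where "isometry_onto X X g" "\<And>x y. (x, y) \<in> ?R \<Longrightarrow> g x = y"
    by (rule extend_partial_isometry[OF X(1,1,2,2,3,3,4,4) _ R]) (use sim in blast)+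
  then show "\<exists>g. isometry_onto X X g \<and> (\<forall>x\<in>A. g x = f x)" by blast
qed

text \<open>Any map between one-point subspaces is an isometry, so homogeneity applies to
  it.\<close>

lemma homogeneous_transitive:
  assumes "homogeneous X" "x \<in> mspace X" "y \<in> mspace X"
  obtains g where "isometry_onto X X g" "g x = y"
proof -
  have "isometry_onto (submetric X {x}) (submetric X {y}) (\<lambda>_. y)"
    using assms(2,3) by (simp add: isometry_onto_def mdist_self)
  then show ?thesis
    using assms that unfolding homogeneous_def
    by (metis empty_subsetI finite.emptyI finite.insertI insert_subset singletonI)
qed

lemma has_simplex_isometry:
  assumes g: "isometry_onto X Y g" and sim: "has_simplex X x r n" and r: "r > 0"
  shows "has_simplex Y (g x) r n"
proof -
  obtain S where S: "finite S" "card S = n" "x \<in> S" "equilateral X r S"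
    using sim by (auto simp: has_simplex_def)
  have SX: "S \<subseteq> mspace X" using S(4) by (simp add: equilateral_def)
  have "has_simplex Y (g x) r (card S)"
  proof (rule has_simplex_image[OF S(1,3) _ r])
    show "g ` S \<subseteq> mspace Y" using g SX by (auto simp: isometry_onto_def)
    fix p q assume pq: "p \<in> S" "q \<in> S" "p \<noteq> q"
    then have "mdist Y (g p) (g q) = mdist X p q"
      using g SX by (auto simp: isometry_onto_def)
    then show "mdist Y (g p) (g q) = r" using S(4) pq by (auto simp: equilateral_def)
  qed
  then show ?thesis using S(2) by simp
qed

lemma homogeneous_has_simplex:
  assumes "homogeneous X" "x \<in> mspace X" "y \<in> mspace X" "r > 0"
  shows "has_simplex X x r n \<longleftrightarrow> has_simplex X y r n"
  using homogeneous_transitive[OF assms(1)] has_simplex_isometry assms(2-4) by metis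

section \<open>Transport along isometries\<close>

text \<open>Preserved distances keep distinct points apart, so \<open>h\<close> is injective on the
  carrier and \<open>inv_into\<close> inverts it on both sides.\<close>

lemma isometry_onto_sym:
  assumes "isometry_onto X Y h"
  obtains g where "isometry_onto Y X g" "\<And>x. x \<in> mspace X \<Longrightarrow> g (h x) = x"
proof
  have g: "inv_into (mspace X) h y \<in> mspace X" "h (inv_into (mspace X) h y) = y"
    if "y \<in> mspace Y" for y
    using that assms inv_into_into f_inv_into_f unfolding isometry_onto_def by metis+
  have inj: "x = x'" if "h x = h x'" "x \<in> mspace X" "x' \<in> mspace X" for x x'
    using that assms mdist_zero mdist_self unfolding isometry_onto_def by (metis imageI)
  show gh: "inv_into (mspace X) h (h x) = x" if x: "x \<in> mspace X" for x
  proof (rule inj)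
    have hx: "h x \<in> mspace Y" using assms x by (auto simp: isometry_onto_def)
    show "h (inv_into (mspace X) h (h x)) = h x" "inv_into (mspace X) h (h x) \<in> mspace X"
      using g[OF hx] by auto
  qed (rule x)
  show "isometry_onto Y X (inv_into (mspace X) h)"
    unfolding isometry_onto_def
  proof (intro conjI ballI equalityI subsetI)
    fix x assume "x \<in> inv_into (mspace X) h ` mspace Y"
    then show "x \<in> mspace X" using g by blast
  next
    fix x assume x: "x \<in> mspace X"
    then have "h x \<in> mspace Y" using assms by (auto simp: isometry_onto_def)
    then show "x \<in> inv_into (mspace X) h ` mspace Y" using gh[OF x] by (metis imageI)
  next
    fix y y' assume "y \<in> mspace Y" "y' \<in> mspace Y"
    then show "mdist X (inv_into (mspace X) h y) (inv_into (mspace X) h y') = mdist Y y y'"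
      using g assms unfolding isometry_onto_def by metis
  qed
qed

lemma separable_space_isometry:
  assumes h: "isometry_onto X Y h" and X: "separable_space (mtopology_of X)"
  shows "separable_space (mtopology_of Y)"
proof -
  obtain D where D: "countable D" "D \<subseteq> mspace X"
    "\<And>x \<epsilon>. x \<in> mspace X \<Longrightarrow> \<epsilon> > 0 \<Longrightarrow> \<exists>d\<in>D. mdist X x d < \<epsilon>"
    using X by (auto simp: separable_space_mtopology_of)
  have "\<exists>d\<in>h ` D. mdist Y y d < \<epsilon>" if y: "y \<in> mspace Y" "\<epsilon> > 0" for y \<epsilon>
  proof -
    obtain x where x: "x \<in> mspace X" "y = h x" using y(1) h unfolding isometry_onto_def by blast
    then obtain d where "d \<in> D" "mdist X x d < \<epsilon>" using D(3) y(2) by blast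
    then show ?thesis using x h D(2) by (auto simp: isometry_onto_def subset_iff)
  qed
  moreover have "h ` D \<subseteq> mspace Y" using D(2) h by (auto simp: isometry_onto_def)
  ultimately show ?thesis
    using countable_image[OF D(1)] unfolding separable_space_mtopology_of
    by (intro exI[of _ "h ` D"]) simp
qed

lemma mcomplete_of_isometry:
  assumes h: "isometry_onto X Y h" and Y: "mcomplete_of Y"
  shows "mcomplete_of X"
  unfolding mcomplete_of_iff
proof
  fix x assume x: "x \<in> Cauchy_seqs X"
  note xm = Cauchy_seqs_mspace[OF x]
  have "(\<lambda>n. h (x n)) \<in> Cauchy_seqs Y"
  proof (rule Cauchy_seqsI)
    show "h (x n) \<in> mspace Y" for n using xm h by (auto simp: isometry_onto_def)
    show "\<exists>N. \<forall>n\<ge>N. \<forall>m\<ge>N. mdist Y (h (x n)) (h (x m)) < \<epsilon>" if "\<epsilon> > 0" for \<epsilon>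
      using Cauchy_seqs_bound[OF x that] xm h by (simp add: isometry_onto_def)
  qed
  then obtain l where "l \<in> mspace Y" "(\<lambda>n. mdist Y (h (x n)) l) \<longlonglongrightarrow> 0"
    using Y by (auto simp: mcomplete_of_iff)
  moreover then obtain l' where "l' \<in> mspace X" "l = h l'"
    using h unfolding isometry_onto_def by blast
  ultimately show "\<exists>l\<in>mspace X. (\<lambda>n. mdist X (x n) l) \<longlonglongrightarrow> 0"
    using xm h by (auto simp: isometry_onto_def)
qed

section \<open>The Cauchy completion\<close>

text \<open>On the carrier this is the canonical isometric embedding of \<open>X\<close> into its
  completion.\<close>

definition const_class :: "'a metric \<Rightarrow> 'a \<Rightarrow> (nat \<Rightarrow> 'a) set" where
  "const_class X x = Cauchy_equiv X `` {\<lambda>_. x}"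

lemma Cauchy_class:
  assumes "x \<in> Cauchy_seqs X"
  shows "Cauchy_equiv X `` {x} \<in> completion_space X" "x \<in> Cauchy_equiv X `` {x}"
  using assms equiv_class_self[OF equiv_Cauchy_equiv]
  by (auto simp: completion_space_def quotientI)

lemma Cauchy_seqs_const: "x \<in> mspace X \<Longrightarrow> (\<lambda>_. x) \<in> Cauchy_seqs X"
  by (rule Cauchy_seqsI) (auto simp: mdist_self)

lemma const_class:
  assumes "x \<in> mspace X"
  shows "const_class X x \<in> completion_space X" "(\<lambda>_. x) \<in> const_class X x"
  using Cauchy_class[OF Cauchy_seqs_const[OF assms]] by (auto simp: const_class_def)

lemma completion_dist_const_class:
  assumes "x \<in> mspace X" "y \<in> mspace X"
  shows "completion_dist X (const_class X x) (const_class X y) = mdist X x y"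
  using completion_dist_eq[OF const_class(1)[OF assms(1)] const_class(1)[OF assms(2)]
      const_class(2)[OF assms(1)] const_class(2)[OF assms(2)]]
  by (simp add: LIMSEQ_const_iff)

lemma completion_dist_const_le:
  assumes c: "c \<in> completion_space X" "z \<in> c" and x: "x \<in> mspace X"
    and le: "\<And>n. n \<ge> N \<Longrightarrow> mdist X (z n) x \<le> \<epsilon>"
  shows "completion_dist X c (const_class X x) \<le> \<epsilon>"
  by (rule LIMSEQ_le_const2[OF completion_dist_eq[OF c(1) const_class(1)[OF x] c(2) const_class(2)[OF x]]])
    (use le in blast)

text \<open>A late term of a representative serves as \<open>x\<close>. The bound
  \<open>\<epsilon>/2\<close> leaves room because a limit preserves only the weak
  inequality.\<close>

lemma const_class_dense:
  assumes c: "c \<in> completion_space X" and e: "\<epsilon> > 0"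
  shows "\<exists>x\<in>mspace X. completion_dist X c (const_class X x) < \<epsilon>"
proof -
  obtain z where z: "z \<in> c" using completion_space_nonempty[OF c] by blast
  then have zC: "z \<in> Cauchy_seqs X" using completion_space_subset[OF c] by blast
  obtain N where N: "\<forall>n\<ge>N. \<forall>m\<ge>N. mdist X (z n) (z m) < \<epsilon>/2"
    using Cauchy_seqs_bound[OF zC, of "\<epsilon>/2"] e by auto
  have "completion_dist X c (const_class X (z N)) \<le> \<epsilon>/2"
    by (rule completion_dist_const_le[OF c z Cauchy_seqs_mspace[OF zC], of N])
      (use N in \<open>auto intro: less_imp_le\<close>)
  then show ?thesis using e Cauchy_seqs_mspace[OF zC, of N] by force
qed

text \<open>Each class \<open>c n\<close> is replaced by the class of a constant \<open>x n\<close>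
  within \<open>1 / (n + 1)\<close>. These points form a Cauchy sequence in \<open>X\<close>, and
  its class is the limit.\<close>

lemma mcomplete_of_Cauchy_completion: "mcomplete_of (Cauchy_completion X)"
  unfolding mcomplete_of_iff
proof
  interpret C: Metric_space "completion_space X" "completion_dist X"
    by (rule Metric_space_completion)
  fix c assume c: "c \<in> Cauchy_seqs (Cauchy_completion X)"
  have cm: "c n \<in> completion_space X" for n
    using Cauchy_seqs_mspace[OF c] by (simp add: mspace_Cauchy_completion)
  have "\<forall>n. \<exists>x\<in>mspace X. completion_dist X (c n) (const_class X x) < inverse (real (Suc n))"
    using const_class_dense[OF cm] by simp
  then obtain x where x: "\<And>n. x n \<in> mspace X"
    and xc: "\<And>n. completion_dist X (c n) (const_class X (x n)) < inverse (real (Suc n))"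
    by metis
  have lim: "(\<lambda>n. completion_dist X (c n) (const_class X (x n))) \<longlonglongrightarrow> 0"
    by (rule tendsto_sandwich[OF _ _ tendsto_const LIMSEQ_inverse_real_of_nat])
      (use xc in \<open>auto intro!: always_eventually less_imp_le\<close>)
  have xC: "x \<in> Cauchy_seqs X"
  proof (rule Cauchy_seqsI[OF x])
    fix \<epsilon> :: real assume e: "\<epsilon> > 0"
    then have e3: "\<epsilon>/3 > 0" by simp
    obtain N1 where N1: "\<And>n. n \<ge> N1 \<Longrightarrow> completion_dist X (c n) (const_class X (x n)) < \<epsilon>/3"
      using order_tendstoD(2)[OF lim e3] unfolding eventually_sequentially by blast
    obtain N2 where N2: "\<And>n m. n \<ge> N2 \<Longrightarrow> m \<ge> N2 \<Longrightarrow> completion_dist X (c n) (c m) < \<epsilon>/3"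
      using Cauchy_seqs_bound[OF c e3] by (auto simp: mdist_Cauchy_completion)
    have "mdist X (x n) (x m) < \<epsilon>" if "n \<ge> max N1 N2" "m \<ge> max N1 N2" for n m
    proof -
      have "mdist X (x n) (x m) = completion_dist X (const_class X (x n)) (const_class X (x m))"
        by (simp add: completion_dist_const_class x)
      also have "\<dots> \<le> completion_dist X (const_class X (x n)) (c n)
          + completion_dist X (c n) (const_class X (x m))"
        by (intro C.triangle const_class x cm)
      also have "\<dots> \<le> completion_dist X (const_class X (x n)) (c n)
          + (completion_dist X (c n) (c m) + completion_dist X (c m) (const_class X (x m)))"
        by (intro add_left_mono C.triangle const_class x cm)
      also have "\<dots> < \<epsilon>"
        using N1[of n] N1[of m] N2[of n m] that C.commute[of "c n"] by simp
      finally show ?thesis .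
    qed
    then show "\<exists>N. \<forall>n\<ge>N. \<forall>m\<ge>N. mdist X (x n) (x m) < \<epsilon>" by blast
  qed
  define l where "l = Cauchy_equiv X `` {x}"
  have l: "l \<in> completion_space X" "x \<in> l" using Cauchy_class[OF xC] by (auto simp: l_def)
  \<comment> \<open>The constants taken from a Cauchy sequence converge to the class of that
    sequence, because its tails have small diameter.\<close>
  have "(\<lambda>n. completion_dist X l (const_class X (x n))) \<longlonglongrightarrow> 0"
  proof (rule LIMSEQ_I)
    fix \<epsilon> :: real assume "\<epsilon> > 0"
    then obtain N where N: "\<forall>n\<ge>N. \<forall>m\<ge>N. mdist X (x n) (x m) < \<epsilon>/2"
      using Cauchy_seqs_bound[OF xC, of "\<epsilon>/2"] by auto
    have "completion_dist X l (const_class X (x n)) \<le> \<epsilon>/2" if "n \<ge> N" for n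
      by (rule completion_dist_const_le[OF l x, of N]) (use N that in \<open>auto intro: less_imp_le\<close>)
    then show "\<exists>N. \<forall>n\<ge>N. norm (completion_dist X l (const_class X (x n)) - 0) < \<epsilon>"
      using \<open>\<epsilon> > 0\<close> by force
  qed
  from tendsto_add[OF lim this]
  have s: "(\<lambda>n. completion_dist X (c n) (const_class X (x n))
      + completion_dist X l (const_class X (x n))) \<longlonglongrightarrow> 0" by simp
  have "(\<lambda>n. completion_dist X (c n) l) \<longlonglongrightarrow> 0"
  proof (rule tendsto_sandwich[OF _ _ tendsto_const s])
    have "completion_dist X (c n) l \<le> completion_dist X (c n) (const_class X (x n))
      + completion_dist X l (const_class X (x n))" for n
      using C.triangle[OF cm const_class(1)[OF x] l(1)] C.commute[of l] by simp
    then show "\<forall>\<^sub>F n in sequentially. completion_dist X (c n) l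
        \<le> completion_dist X (c n) (const_class X (x n)) + completion_dist X l (const_class X (x n))"
      by simp
  qed simp
  then show "\<exists>l\<in>mspace (Cauchy_completion X). (\<lambda>n. mdist (Cauchy_completion X) (c n) l) \<longlonglongrightarrow> 0"
    using l(1) by (auto simp: mspace_Cauchy_completion mdist_Cauchy_completion)
qed

lemma ultrametric_Cauchy_completion:
  assumes X: "ultrametric X"
  shows "ultrametric (Cauchy_completion X)"
  unfolding ultrametric_def mspace_Cauchy_completion mdist_Cauchy_completion
proof (intro ballI)
  fix a b c assume m: "a \<in> completion_space X" "b \<in> completion_space X" "c \<in> completion_space X"
  then obtain x y z where xyz: "x \<in> a" "y \<in> b" "z \<in> c"
    using completion_space_nonempty by metis
  then have C: "x \<in> Cauchy_seqs X" "y \<in> Cauchy_seqs X" "z \<in> Cauchy_seqs X"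
    using m completion_space_subset by blast+
  show "completion_dist X a c \<le> max (completion_dist X a b) (completion_dist X b c)"
  proof (rule LIMSEQ_le[OF completion_dist_eq[OF m(1,3) xyz(1,3)]])
    show "(\<lambda>n. max (mdist X (x n) (y n)) (mdist X (y n) (z n)))
        \<longlonglongrightarrow> max (completion_dist X a b) (completion_dist X b c)"
      by (intro tendsto_max completion_dist_eq m xyz)
    show "\<exists>N. \<forall>n\<ge>N. mdist X (x n) (z n) \<le> max (mdist X (x n) (y n)) (mdist X (y n) (z n))"
      using X C Cauchy_seqs_mspace unfolding ultrametric_def by metis
  qed
qed

lemma separable_Cauchy_completion:
  assumes "countable (mspace X)"
  shows "separable_space (mtopology_of (Cauchy_completion X))"
  unfolding separable_space_mtopology_of mspace_Cauchy_completion mdist_Cauchy_completion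
  using assms const_class const_class_dense
  by (intro exI[of _ "const_class X ` mspace X"]) fastforce

section \<open>The spaces of finitely supported functions\<close>

lemma ultrametric_Fin_metric: "V \<subseteq> {0..} \<Longrightarrow> ultrametric (Fin_metric V s)"
  by (simp add: ultrametric_def mspace_Fin_metric mdist_Fin_metric Fin_dist_ultra)

text \<open>A function is recovered from its support and its values there. There are countably many
  finite subsets of \<open>V\<close>, each with countably many value assignments.\<close>

lemma countable_Fin_space:
  assumes "countable V"
  shows "countable (Fin_space V s)"
proof -
  \<comment> \<open>Extension by 0 on \<open>V - {0}\<close> and by \<open>undefined\<close>
    outside. The bounds from \<open>s\<close> are dropped, so the union below is only a countable
    superset.\<close>
  let ?ext = "\<lambda>F g. \<lambda>r\<in>V - {0}. if r \<in> F then g r else (0::nat)"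
  have "f \<in> (\<Union>F\<in>{F. F \<subseteq> V \<and> finite F}. ?ext F ` (\<Pi>\<^sub>E r\<in>F. UNIV))" if "f \<in> Fin_space V s" for f
  proof
    have f: "f \<in> (\<Pi>\<^sub>E r\<in>V - {0}. {k. enat k < s r})" "finite (supp V f)"
      using that by (auto simp: Fin_space_def)
    then show "supp V f \<in> {F. F \<subseteq> V \<and> finite F}" by (auto simp: supp_def)
    have "f = ?ext (supp V f) (restrict f (supp V f))"
      using f(1) by (auto simp: supp_def fun_eq_iff PiE_def extensional_def)
    then show "f \<in> ?ext (supp V f) ` (\<Pi>\<^sub>E r\<in>supp V f. UNIV)"
      by (rule image_eqI[where x = "restrict f (supp V f)"]) auto
  qed
  moreover have "countable (\<Union>F\<in>{F. F \<subseteq> V \<and> finite F}. ?ext F ` (\<Pi>\<^sub>E r\<in>F. UNIV))"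
    by (intro countable_UN countable_image countable_PiE)
      (auto simp: conj_commute countable_Collect_finite_subset[OF assms])
  ultimately show ?thesis by (meson countable_subset subsetI)
qed

lemma Fin_space_nonempty:
  assumes "\<forall>r\<in>V - {0}. 2 \<le> s r"
  shows "(\<lambda>r\<in>V - {0}. 0) \<in> Fin_space V s"
proof -
  have "enat 0 < s r" if "r \<in> V - {0}" for r
    using assms that by (metis enat_0 less_le_trans zero_less_numeral)
  moreover have "supp V (\<lambda>r\<in>V - {0}. 0) = {}" by (auto simp: supp_def)
  ultimately show ?thesis by (auto simp: Fin_space_def)
qed

lemma Fin_space_upd:
  assumes "f \<in> Fin_space V s" "r \<in> V - {0}" "enat k < s r"
  shows "f(r := k) \<in> Fin_space V s"
proof -
  have "supp V (f(r := k)) \<subseteq> insert r (supp V f)" by (auto simp: supp_def)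
  then have "finite (supp V (f(r := k)))"
    using assms(1) by (auto simp: Fin_space_def intro: finite_subset)
  then show ?thesis using assms by (auto simp: Fin_space_def PiE_def extensional_def)
qed

lemma Fin_dist_upd:
  assumes "f \<in> Fin_space V s" "r \<in> V - {0}" "enat k < s r" "enat l < s r" "k \<noteq> l"
  shows "Fin_dist V s (f(r := k)) (f(r := l)) = r"
proof -
  have ne: "f(r := k) \<noteq> f(r := l)" using assms(5) by (metis fun_upd_same)
  note m = Fin_space_upd[OF assms(1-3)] Fin_space_upd[OF assms(1,2,4)]
  show ?thesis
    using Fin_dist_in(2)[OF m ne] by (auto split: if_splits)
qed

text \<open>Distinct points of an \<open>r\<close>-equilateral set differ at coordinate
  \<open>r\<close>, so evaluation at \<open>r\<close> embeds the set into the ordinal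
  \<open>s r\<close>. Conversely, changing only coordinate \<open>r\<close> of \<open>f\<close>
  gives points at mutual distance \<open>r\<close>.\<close>

lemma has_simplex_Fin_metric:
  assumes V: "V \<subseteq> {0..}" and f: "f \<in> Fin_space V s" and r: "r > 0"
  shows "has_simplex (Fin_metric V s) f r n \<longleftrightarrow> n = 1 \<or> 2 \<le> n \<and> r \<in> V \<and> enat n \<le> s r"
proof
  assume "has_simplex (Fin_metric V s) f r n"
  then obtain S where S: "finite S" "card S = n" "f \<in> S" "S \<subseteq> Fin_space V s"
    and d: "\<And>g h. g \<in> S \<Longrightarrow> h \<in> S \<Longrightarrow> g \<noteq> h \<Longrightarrow> Fin_dist V s g h = r"
    by (auto simp: has_simplex_def equilateral_def mspace_Fin_metric mdist_Fin_metric V)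
  show "n = 1 \<or> 2 \<le> n \<and> r \<in> V \<and> enat n \<le> s r"
  proof (cases "n = 1")
    case False
    have "n \<noteq> 0" using S(1-3) by (metis card_0_eq empty_iff)
    with False have n: "2 \<le> n" by simp
    then have "S \<noteq> {f}" using S(2) by auto
    then obtain g where g: "g \<in> S" "g \<noteq> f" using S(3) by blast
    have rV: "r \<in> V - {0}"
      using Fin_dist_in(1)[of g V s f] d[OF g(1) S(3) g(2)] g S by auto
    have "inj_on (\<lambda>g. g r) S"
    proof (rule inj_onI, rule ccontr)
      fix g h assume gh: "g \<in> S" "h \<in> S" "g r = h r" "g \<noteq> h"
      then show False using Fin_dist_in(2)[of g V s h] d[of g h] S(4) by auto
    qed
    then have card: "card ((\<lambda>g. g r) ` S) = n" using S(2) by (simp add: card_image)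
    have sub: "(\<lambda>g. g r) ` S \<subseteq> {k. enat k < s r}"
      using S(4) rV by (auto simp: Fin_space_def PiE_def Pi_def)
    have "enat n \<le> s r"
    proof (cases "s r")
      case (enat m)
      then have "(\<lambda>g. g r) ` S \<subseteq> {..<m}" using sub by auto
      then have "n \<le> m" using card card_mono[of "{..<m}"] by fastforce
      then show ?thesis using enat by simp
    qed simp
    then show ?thesis using n rV by simp
  qed simp
next
  assume "n = 1 \<or> 2 \<le> n \<and> r \<in> V \<and> enat n \<le> s r"
  then consider "n = 1" | "2 \<le> n" "r \<in> V" "enat n \<le> s r" by blast
  then show "has_simplex (Fin_metric V s) f r n"
  proof cases
    case 1
    then show ?thesis
      using V f unfolding has_simplex_def
      by (intro exI[of _ "{f}"]) (auto simp: equilateral_def mspace_Fin_metric)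
  next
    case 2
    have rV: "r \<in> V - {0}" using 2 r by simp
    \<comment> \<open>The values must include \<open>f r\<close> so that \<open>f\<close> is a
      vertex. If \<open>f r\<close> is not below \<open>n\<close>, it takes the place of
      \<open>n - 1\<close> among the first \<open>n\<close> numbers.\<close>
    obtain K where K: "finite K" "card K = n" "f r \<in> K" "\<And>k. k \<in> K \<Longrightarrow> enat k < s r"
    proof (cases "f r < n")
      case True
      have "enat k < s r" if "k < n" for k
        using that 2(3) by (meson enat_ord_simps(2) less_le_trans)
      then show ?thesis using that[of "{..<n}"] True by auto
    next
      case False
      have "enat (f r) < s r" using f rV by (auto simp: Fin_space_def)
      moreover have "enat k < s r" if "k < n - 1" for k
        using that 2(3) by (metis add_lessD1 enat_ord_simps(2) less_diff_conv less_le_trans)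
      moreover have "card (insert (f r) {..<n - 1}) = n" using False 2(1) by auto
      ultimately show ?thesis using that[of "insert (f r) {..<n - 1}"] by auto
    qed
    \<comment> \<open>The base vertex \<open>f\<close> is written as the image of \<open>f r\<close>
      under the family indexed by \<open>K\<close>.\<close>
    have "has_simplex (Fin_metric V s) (f(r := f r)) r (card K)"
      by (rule has_simplex_image[OF K(1,3) _ r, where g = "\<lambda>k. f(r := k)"])
        (use Fin_space_upd[OF f rV] Fin_dist_upd[OF f rV] K(4) in
          \<open>auto simp: mspace_Fin_metric mdist_Fin_metric V\<close>)
    then show ?thesis using K(2) by simp
  qed
qed

text \<open>The invariant at \<open>c\<close> equals the invariant at some \<open>f\<close> of the
  dense embedded copy, and that is the same for all \<open>f\<close>.\<close>

lemma has_simplex_completion_Fin: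
  assumes V: "V \<subseteq> {0..}" and c: "c \<in> mspace (Cauchy_completion (Fin_metric V s))" and r: "r > 0"
  shows "has_simplex (Cauchy_completion (Fin_metric V s)) c r n \<longleftrightarrow>
    n = 1 \<or> 2 \<le> n \<and> r \<in> V \<and> enat n \<le> s r"
proof -
  let ?F = "Fin_metric V s"
  obtain f where "f \<in> mspace ?F"
    "\<And>n. has_simplex (Cauchy_completion ?F) c r n \<longleftrightarrow> has_simplex ?F f r n"
  proof (rule has_simplex_dense[OF ultrametric_Cauchy_completion[OF ultrametric_Fin_metric[OF V]]
        _ _ _ r c, where e = "const_class ?F"])
  qed (auto simp: mspace_Cauchy_completion mdist_Cauchy_completion completion_dist_const_class
      const_class const_class_dense)
  then show ?thesis
    using has_simplex_Fin_metric[OF V _ r] by (simp add: mspace_Fin_metric V)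
qed

section \<open>The characterisation\<close>

lemma has_simplex_pair:
  assumes "has_simplex X x r n" "2 \<le> n" "r > 0"
  obtains y where "x \<in> mspace X" "y \<in> mspace X" "mdist X x y = r"
proof -
  obtain S where S: "card S = n" "x \<in> S" "equilateral X r S"
    using assms(1) by (auto simp: has_simplex_def)
  have "S \<noteq> {x}" using S(1) assms(2) by auto
  then obtain y where "y \<in> S" "y \<noteq> x" using S(2) by blast
  then show ?thesis using that[of y] S by (auto simp: equilateral_def)
qed

text \<open>\<open>V\<close> and \<open>s\<close> are read off the invariant at one point
  \<open>x0\<close>. The completion built from them has the same invariant everywhere, so
  back-and-forth from the empty relation gives the isometry.\<close>

lemma homogeneous_imp_isometric:
  assumes X: "ultrametric X" "mspace X \<noteq> {}" "separable_space (mtopology_of X)" "mcomplete_of X"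
    and hom: "homogeneous X"
  obtains V s where "countable V" "V \<subseteq> {0..}" "0 \<in> V" "\<forall>r\<in>V - {0}. 2 \<le> s r"
    "isometric X (Cauchy_completion (Fin_metric V s))"
proof -
  obtain x0 where x0: "x0 \<in> mspace X" using X(2) by blast
  obtain D where D: "countable D" "D \<subseteq> mspace X"
    "\<And>x \<epsilon>. x \<in> mspace X \<Longrightarrow> \<epsilon> > 0 \<Longrightarrow> \<exists>d\<in>D. mdist X x d < \<epsilon>"
    using X(3) by (auto simp: separable_space_mtopology_of)
  \<comment> \<open>The positive elements are the distances from \<open>x0\<close>; by homogeneity
    these are all positive distances in \<open>X\<close>.\<close>
  define V where "V = insert 0 {r. r > 0 \<and> has_simplex X x0 r 2}"
  \<comment> \<open>The supremum in \<open>enat\<close> is \<open>\<infinity>\<close>, the ordinal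
    \<open>\<omega>\<close>, when simplices of unbounded size exist.\<close>
  define s where "s r = (SUP n\<in>{n. has_simplex X x0 r n}. enat n)" for r
  have V: "V \<subseteq> {0..}" "0 \<in> V" by (auto simp: V_def)
  \<comment> \<open>A distance \<open>r > 0\<close> from \<open>x0\<close> is also attained on
    \<open>D\<close>: a point of \<open>D\<close> closer than \<open>r\<close> to \<open>y\<close>
    has the same distance from \<open>x0\<close> as \<open>y\<close>.\<close>
  have "r \<in> insert 0 (mdist X x0 ` D)" if "r \<in> V" for r
  proof (cases "r = 0")
    case False
    then have r: "r > 0" "has_simplex X x0 r 2" using that by (auto simp: V_def)
    obtain y where y: "y \<in> mspace X" "mdist X x0 y = r"
      using has_simplex_pair[OF r(2) _ r(1)] by auto
    obtain d where d: "d \<in> D" "mdist X y d < r" using D(3)[OF y(1) r(1)] by blast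
    then have "mdist X d x0 = mdist X y x0"
      using ultrametric_isosceles[OF X(1), of d y x0] D(2) y x0 by (auto simp: mdist_commute)
    then show ?thesis using d(1) y(2) by (auto simp: mdist_commute)
  qed simp
  then have "countable V"
    by (meson D(1) countable_image countable_insert countable_subset subsetI)
  have s2: "\<forall>r\<in>V - {0}. 2 \<le> s r"
    unfolding s_def V_def by (auto intro!: SUP_upper2[of 2] simp: numeral_eq_enat)
  have sim0: "has_simplex X x0 r n \<longleftrightarrow> n = 1 \<or> 2 \<le> n \<and> r \<in> V \<and> enat n \<le> s r"
    if r: "r > 0" for r n
  proof (cases "2 \<le> n")
    case False
    have "has_simplex X x0 r 1"
      unfolding has_simplex_def using x0 by (intro exI[of _ "{x0}"]) (auto simp: equilateral_def)
    moreover have "\<not> has_simplex X x0 r 0" by (auto simp: has_simplex_def)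
    moreover have "n = 0 \<or> n = 1" using False by auto
    ultimately show ?thesis by auto
  next
    case True
    have "has_simplex X x0 r n" if "r \<in> V" "enat n \<le> s r"
    proof (rule ccontr)
      assume not: "\<not> has_simplex X x0 r n"
      \<comment> \<open>Sizes are closed downwards as far as 1, so failure at \<open>n\<close> caps
        the supremum at \<open>n - 1\<close>.\<close>
      have "m \<le> n - 1" if "has_simplex X x0 r m" for m
        using has_simplex_mono[OF that, of n] not True by (cases "n \<le> m") auto
      then have "s r \<le> enat (n - 1)" unfolding s_def by (auto intro!: SUP_least)
      with that(2) have "enat n \<le> enat (n - 1)" by (rule order_trans)
      then show False using True by simp
    qed
    moreover have "r \<in> V" "enat n \<le> s r" if "has_simplex X x0 r n"
      using has_simplex_mono[OF that, of 2] True r that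
      by (auto simp: V_def s_def intro: SUP_upper)
    ultimately show ?thesis using True by auto
  qed
  let ?C = "Cauchy_completion (Fin_metric V s)"
  have sim: "has_simplex X x r n \<longleftrightarrow> has_simplex ?C c r n"
    if "x \<in> mspace X" "c \<in> mspace ?C" "r > 0" for x c r n
    using that homogeneous_has_simplex[OF hom that(1) x0 that(3)] sim0[OF that(3)]
      has_simplex_completion_Fin[OF V(1) that(2,3)] by simp
  have neC: "mspace ?C \<noteq> {}"
    using const_class(1)[of _ "Fin_metric V s"] Fin_space_nonempty[OF s2]
    by (auto simp: mspace_Cauchy_completion mspace_Fin_metric V)
  have sepC: "separable_space (mtopology_of ?C)"
    by (intro separable_Cauchy_completion)
      (simp add: mspace_Fin_metric V countable_Fin_space \<open>countable V\<close>)
  have emp: "partial_isometry X ?C {}" by (simp add: partial_isometry_def)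
  obtain g where "isometry_onto X ?C g"
    using extend_partial_isometry[OF X(1) ultrametric_Cauchy_completion[OF ultrametric_Fin_metric[OF V(1)]]
        X(2) neC X(3) sepC X(4) mcomplete_of_Cauchy_completion sim emp] by auto
  then show ?thesis
    using that[OF \<open>countable V\<close> V s2] by (auto simp: isometric_def)
qed

theorem theorem3:
  fixes X :: "'a metric"
  assumes "mspace X \<noteq> {}" and "ultrametric X"
  shows "separable_space (mtopology_of X) \<and> mcomplete_of X \<and> homogeneous X \<longleftrightarrow>
    (\<exists>(V :: real set) (s :: real \<Rightarrow> enat).
       countable V \<and> V \<subseteq> {0..} \<and> 0 \<in> V \<and> (\<forall>r \<in> V - {0}. 2 \<le> s r) \<and>
       isometric X (Cauchy_completion (Fin_metric V s)))"
proof
  assume "separable_space (mtopology_of X) \<and> mcomplete_of X \<and> homogeneous X"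
  then show "\<exists>(V :: real set) (s :: real \<Rightarrow> enat).
       countable V \<and> V \<subseteq> {0..} \<and> 0 \<in> V \<and> (\<forall>r \<in> V - {0}. 2 \<le> s r) \<and>
       isometric X (Cauchy_completion (Fin_metric V s))"
    using homogeneous_imp_isometric[OF assms(2,1)] by metis
next
  assume "\<exists>(V :: real set) (s :: real \<Rightarrow> enat).
       countable V \<and> V \<subseteq> {0..} \<and> 0 \<in> V \<and> (\<forall>r \<in> V - {0}. 2 \<le> s r) \<and>
       isometric X (Cauchy_completion (Fin_metric V s))"
  then obtain V :: "real set" and s h where V: "countable V" "V \<subseteq> {0..}"
    and h: "isometry_onto X (Cauchy_completion (Fin_metric V s)) h"
    by (auto simp: isometric_def)
  obtain g where g: "isometry_onto (Cauchy_completion (Fin_metric V s)) X g"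
    "\<And>x. x \<in> mspace X \<Longrightarrow> g (h x) = x"
    using isometry_onto_sym[OF h] by metis
  have sep: "separable_space (mtopology_of X)"
    by (intro separable_space_isometry[OF g(1)] separable_Cauchy_completion)
      (simp add: mspace_Fin_metric V countable_Fin_space)
  have complete: "mcomplete_of X"
    by (rule mcomplete_of_isometry[OF h mcomplete_of_Cauchy_completion])
  \<comment> \<open>The right-hand side does not mention \<open>x\<close>, which is what
    \<open>homogeneousI\<close> asks for. Simplices move along \<open>h\<close> and return along
    \<open>g\<close>, with \<open>g (h x) = x\<close>.\<close>
  have "has_simplex X x r n \<longleftrightarrow> n = 1 \<or> 2 \<le> n \<and> r \<in> V \<and> enat n \<le> s r"
    if x: "x \<in> mspace X" and r: "r > 0" for x r n
  proof -
    have hx: "h x \<in> mspace (Cauchy_completion (Fin_metric V s))"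
      using x h by (auto simp: isometry_onto_def)
    have "has_simplex X x r n \<longleftrightarrow> has_simplex (Cauchy_completion (Fin_metric V s)) (h x) r n"
      using has_simplex_isometry[OF h _ r, of x] has_simplex_isometry[OF g(1) _ r, of "h x"] g(2)[OF x]
      by auto
    then show ?thesis using has_simplex_completion_Fin[OF V(2) hx r] by simp
  qed
  then have "homogeneous X"
    by (intro homogeneousI[OF assms(2,1) sep complete]) simp
  then show "separable_space (mtopology_of X) \<and> mcomplete_of X \<and> homogeneous X"
    using sep complete by blast
qed

end
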